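(* Let $\omega=(\omega_1,\dots,\omega_n)\in\mathbb{C}^n$ and let $A=\mathrm{diag}(\omega_1,\dots,\omega_n)\in GL(n,\mathbb{C})$ be non-resonant. Let $(M_k)_{k\ge1}$ and $(N_k)_{k\ge1}$ be sequences of positive real numbers verifying hypotheses 0)--3) listed in the context. Let $\mathbf{F}\in V_0$ be of the form $\mathbf{F}(\mathbf{z})=A\mathbf{z}+\mathbf{f}(\mathbf{z})$ with $\mathbf{f}\in V_1$, and let $\mathbf{h}$ be the linearization of the vector field $\dot{\mathbf{z}}=\mathbf{F}(\mathbf{z})$. Then: (1) If moreover $\mathbf{F}\in\mathcal{C}_{(M_k)}\cap V_0$ and $A$ verifies the Bruno condition $$\sum_{k\ge0}\frac{\log\hat\Omega^{-1}(p_{k+1})}{p_k}<+\infty$$ for some increasing sequence of integers $(p_k)_k$, then the linearization $\mathbf{h}$ also belongs to $\mathcal{C}_{(M_k)}\cap V_1$. (2) If $\mathbf{F}$ is a germ of analytic diffeomorphism of $(\mathbb{C}^n,0)$ and there exists an increasing sequence of integers $(p_k)_k$ such that $$\limsup_{|\alpha|\to+\infty}\left(2\sum_{m=0}^{\kappa(\alpha)}\frac{\log\hat\Omega^{-1}(p_{m+1})}{p_m}-\frac1{|\alpha|}\log N_{|\alpha|}\right)<+\infty,$$ where $\kappa(\alpha)$ is the integer defined by $p_{\kappa(\alpha)}\le|\alpha|<p_{\kappa(\alpha)+1}$, then $\mathbf{h}\in\mathcal{C}_{(N_k)}\cap V_1$. (3) If $\mathbf{F}\in\mathcal{C}_{(M_k)}\cap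 V_0$, $(M_k)_k$ is asymptotically bounded by $(N_k)_k$ (namely $N_k\ge M_k$ for all sufficiently large $k$), and there exists an increasing sequence of integers $(p_k)_k$ such that $$\limsup_{|\alpha|\to+\infty}\left(2\sum_{m=0}^{\kappa(\alpha)}\frac{\log\hat\Omega^{-1}(p_{m+1})}{p_m}-\frac1{|\alpha|}\log\frac{N_{|\alpha|}}{M_{|\alpha|}}\right)<+\infty,$$ where $\kappa(\alpha)$ is the integer defined by $p_{\kappa(\alpha)}\le|\alpha|<p_{\kappa(\alpha)+1}$, then $\mathbf{h}\in\mathcal{C}_{(N_k)}\cap V_1$.
   Context: For a multi-index $\alpha$, $|\alpha|=\alpha_1+\dots+\alpha_n$, $z^\alpha=z_1^{\alpha_1}\cdots z_n^{\alpha_n}$, $\omega\cdot\alpha=\sum_i\omega_i\alpha_i$. $V=\mathbb{C}^n[[z_1,\dots,z_n]]$ is the space of formal power series $\mathbf{f}=\sum_{\alpha\in\mathbb{N}^n}\mathbf{f}_\alpha z^\alpha$, $\mathbf{f}_\alpha\in\mathbb{C}^n$; $v(\mathbf{f})=\inf\{|\alpha|:\mathbf{f}_\alpha\ne0\}$ and $V_j=\{\mathbf{f}\in V:v(\mathbf{f})>j\}$. $A=\mathrm{diag}(\omega_1,\dots,\omega_n)$ is resonant if there exist $\alpha\in\mathbb{Z}^n$, with all components non-negative except at most one which can assume the value $-1$, $|\alpha|\ge2$, and $j\in\{1,\dots,n\}$ such that $\omega\cdot\alpha-\omega_j=0$; otherwise it is non-resonant. When $A$ is non-resonant, the linearization is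 the unique $\mathbf{h}\in V_1$ such that the change of variables $\mathbf{z}=\mathbf{w}+\mathbf{h}(\mathbf{w})$ transforms $\dot{\mathbf{z}}=A\mathbf{z}+\mathbf{f}(\mathbf{z})$ into $\dot{\mathbf{w}}=A\mathbf{w}$; equivalently $\sum_{i=1}^n(A\mathbf{w})_i\partial_{w_i}\mathbf{h}(\mathbf{w})-A\mathbf{h}(\mathbf{w})=\mathbf{f}(\mathbf{w}+\mathbf{h}(\mathbf{w}))$. Hypotheses on a sequence $(M_k)_{k\ge1}$ of positive reals: 0) $\inf_{k\ge1}M_k^{1/k}>0$; 1) there exists $C_1>0$ such that $M_{k+1}\le C_1^{k+1}M_k$ for all $k\ge1$; 2) $(M_k)_{k\ge1}$ is logarithmically convex; 3) $M_kM_l\le M_{k+l-1}$ for all $k,l\ge1$. The class $\mathcal{C}_{(M_k)}$ is the set of $\mathbf{f}=\sum\mathbf{f}_\alpha z^\alpha\in V$ for which there exist constants $A,B>0$ with $|\mathbf{f}_\alpha|\le AB^{|\alpha|}M_{|\alpha|}$ for all $\alpha\in\mathbb{N}^n$ with $|\alpha|\ge1$. Small divisors: for an integer $p\ge2$, $$\hat\Omega(p)=\min\{|\alpha\cdot\omega|:\alpha\in\mathbb{Z}^n,\ \alpha\cdot\omega\ne0,\ 0<|\alpha|<p,\ \text{all }\alpha_i\ge0\text{ except at most one, which may equal }-1\}.$$ The sequences $(p_k)_k$ are increasing sequences of positive integers. *)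

theory Defs
  imports "HOL-Analysis.Analysis"
begin

section \<open>Multi-indices\<close>

text \<open>
  Multi-indices in \<open>\<nat>\<^sup>n\<close> and \<open>\<int>\<^sup>n\<close> are elements of \<^typ>\<open>nat ^ 'n\<close> and \<^typ>\<open>int ^ 'n\<close>.  For integer
  multi-indices the length is the plain sum of the components, so that an entry \<open>-1\<close> counts
  negatively.
\<close>

definition mdeg :: "'a::comm_monoid_add ^ 'n \<Rightarrow> 'a"  (\<open>\<bar>_\<bar>\<^sub>m\<close>)
  where "\<bar>\<alpha>\<bar>\<^sub>m = (\<Sum>i\<in>UNIV. \<alpha> $ i)"

definition mpow :: "'a::comm_monoid_mult ^ 'n \<Rightarrow> nat ^ 'n \<Rightarrow> 'a"
  where "mpow z \<alpha> = (\<Prod>i\<in>UNIV. (z $ i) ^ (\<alpha> $ i))"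

lemma finite_mindex_le: "finite {\<alpha> :: nat ^ 'n. \<forall>i. \<alpha> $ i \<le> \<gamma> $ i}"
proof (rule finite_subset)
  show "{\<alpha> :: nat ^ 'n. \<forall>i. \<alpha> $ i \<le> \<gamma> $ i} \<subseteq> vec_lambda ` (\<Pi>\<^sub>E i\<in>UNIV. {..\<gamma> $ i})"
  proof
    fix \<alpha> :: "nat ^ 'n"
    assume "\<alpha> \<in> {\<alpha>. \<forall>i. \<alpha> $ i \<le> \<gamma> $ i}"
    then show "\<alpha> \<in> vec_lambda ` (\<Pi>\<^sub>E i\<in>UNIV. {..\<gamma> $ i})"
      by (intro image_eqI[where x="vec_nth \<alpha>"]) (simp_all add: PiE_UNIV_domain)
  qed
  show "finite (vec_lambda ` (\<Pi>\<^sub>E i\<in>(UNIV :: 'n set). {..\<gamma> $ i}))"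
    by (intro finite_imageI finite_PiE) simp_all
qed

lemma finite_mindex_decomp: "finite {(\<alpha>, \<beta>). \<alpha> + \<beta> = (\<gamma> :: nat ^ 'n)}"
proof (rule finite_subset)
  show "{(\<alpha>, \<beta>). \<alpha> + \<beta> = \<gamma>}
    \<subseteq> {\<alpha>. \<forall>i. \<alpha> $ i \<le> \<gamma> $ i} \<times> {\<alpha>. \<forall>i. \<alpha> $ i \<le> \<gamma> $ i}"
    by auto
  show "finite ({\<alpha>. \<forall>i. \<alpha> $ i \<le> \<gamma> $ i} \<times> {\<alpha>. \<forall>i. \<alpha> $ i \<le> \<gamma> $ i})"
    by (intro finite_cartesian_product finite_mindex_le)
qed

lemma finite_mdeg_le: "finite {\<alpha> :: nat ^ 'n. \<bar>\<alpha>\<bar>\<^sub>m \<le> d}"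
proof (rule finite_subset)
  show "{\<alpha> :: nat ^ 'n. \<bar>\<alpha>\<bar>\<^sub>m \<le> d} \<subseteq> {\<alpha>. \<forall>i. \<alpha> $ i \<le> (\<chi> i. d) $ i}"
  proof (intro subsetI CollectI allI)
    fix \<alpha> :: "nat ^ 'n" and i
    assume "\<alpha> \<in> {\<alpha>. \<bar>\<alpha>\<bar>\<^sub>m \<le> d}"
    moreover have "\<alpha> $ i \<le> \<bar>\<alpha>\<bar>\<^sub>m"
      unfolding mdeg_def by (rule member_le_sum) simp_all
    ultimately show "\<alpha> $ i \<le> (\<chi> i. d) $ i"
      by simp
  qed
qed (rule finite_mindex_le)


section \<open>Formal power series in the variables \<open>z\<^sub>i\<close>, \<open>i :: 'n\<close>\<close>

typedef ('a, 'n) mfps = "UNIV :: (nat ^ 'n \<Rightarrow> 'a) set"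
  morphisms mfps_nth Abs_mfps
  by simp

lemma mfps_nth_Abs [simp]: "mfps_nth (Abs_mfps c) = c"
  by (simp add: Abs_mfps_inverse)

lemma mfps_eqI: "(\<And>\<alpha>. mfps_nth f \<alpha> = mfps_nth g \<alpha>) \<Longrightarrow> f = g"
  by (metis ext mfps_nth_inject)

instantiation mfps :: (comm_ring_1, finite) comm_ring_1
begin

definition "0 = Abs_mfps (\<lambda>\<alpha>. 0)"
definition "1 = Abs_mfps (\<lambda>\<alpha>. if \<alpha> = 0 then 1 else 0)"
definition "f + g = Abs_mfps (\<lambda>\<alpha>. mfps_nth f \<alpha> + mfps_nth g \<alpha>)"
definition "f - g = Abs_mfps (\<lambda>\<alpha>. mfps_nth f \<alpha> - mfps_nth g \<alpha>)"
definition "- f = Abs_mfps (\<lambda>\<alpha>. - mfps_nth f \<alpha>)"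
definition "f * g =
  Abs_mfps (\<lambda>\<gamma>. \<Sum>(\<alpha>, \<beta>) \<in> {(\<alpha>, \<beta>). \<alpha> + \<beta> = \<gamma>}. mfps_nth f \<alpha> * mfps_nth g \<beta>)"

instance
proof
  fix f g h :: "('a, 'b) mfps"
  show "f * g * h = f * (g * h)"
  proof (rule mfps_eqI)
    fix \<nu> :: "nat ^ 'b"
    define D :: "nat ^ 'b \<Rightarrow> ((nat ^ 'b) \<times> (nat ^ 'b)) set"
      where "D \<gamma> = {(\<alpha>, \<beta>). \<alpha> + \<beta> = \<gamma>}" for \<gamma>
    have fin: "finite (D \<gamma>)" for \<gamma>
      unfolding D_def by (rule finite_mindex_decomp)
    have "mfps_nth (f * g * h) \<nu> =
        (\<Sum>p\<in>D \<nu>. \<Sum>q\<in>D (fst p). mfps_nth f (fst q) * mfps_nth g (snd q) * mfps_nth h (snd p))"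
      by (simp add: times_mfps_def D_def case_prod_unfold sum_distrib_right)
    also have "\<dots> = (\<Sum>(p, q)\<in>Sigma (D \<nu>) (\<lambda>p. D (fst p)).
        mfps_nth f (fst q) * mfps_nth g (snd q) * mfps_nth h (snd p))"
      by (rule sum.Sigma) (auto simp: fin)
    also have "\<dots> = (\<Sum>(p, q)\<in>Sigma (D \<nu>) (\<lambda>p. D (snd p)).
        mfps_nth f (fst p) * (mfps_nth g (fst q) * mfps_nth h (snd q)))"
      by (rule sum.reindex_bij_witness
            [where j="\<lambda>(p, q). ((fst q, snd q + snd p), (snd q, snd p))"
               and i="\<lambda>(p, q). ((fst p + fst q, snd q), (fst p, fst q))"])
         (auto simp: D_def add.assoc mult.assoc)
    also have "\<dots> = (\<Sum>p\<in>D \<nu>. \<Sum>q\<in>D (snd p).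
        mfps_nth f (fst p) * (mfps_nth g (fst q) * mfps_nth h (snd q)))"
      by (rule sum.Sigma[symmetric]) (auto simp: fin)
    also have "\<dots> = mfps_nth (f * (g * h)) \<nu>"
      by (simp add: times_mfps_def D_def case_prod_unfold sum_distrib_left)
    finally show "mfps_nth (f * g * h) \<nu> = mfps_nth (f * (g * h)) \<nu>" .
  qed
  show "f * g = g * f"
    unfolding times_mfps_def
    by (rule arg_cong[where f=Abs_mfps], rule ext,
        rule sum.reindex_bij_witness[where i="\<lambda>(a, b). (b, a)" and j="\<lambda>(a, b). (b, a)"])
       (auto simp: add.commute mult.commute)
  show "1 * f = f"
  proof (rule mfps_eqI)
    fix \<nu>
    have "mfps_nth (1 * f) \<nu> =
        (\<Sum>(\<alpha>, \<beta>) \<in> {(\<alpha>, \<beta>). \<alpha> + \<beta> = \<nu>}. (if \<alpha> = 0 then 1 else 0) * mfps_nth f \<beta>)"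
      by (simp add: times_mfps_def one_mfps_def)
    also have "\<dots> = (\<Sum>(\<alpha>, \<beta>) \<in> {(0 :: nat ^ 'b, \<nu>)}. (if \<alpha> = 0 then 1 else 0) * mfps_nth f \<beta>)"
      by (rule sum.mono_neutral_right) (auto simp: finite_mindex_decomp split: if_splits)
    finally show "mfps_nth (1 * f) \<nu> = mfps_nth f \<nu>" by simp
  qed
  show "(f + g) * h = f * h + g * h"
    by (rule mfps_eqI)
       (simp only: times_mfps_def plus_mfps_def mfps_nth_Abs case_prod_unfold distrib_right
          sum.distrib)
  show "f + g + h = f + (g + h)"
    by (simp only: plus_mfps_def mfps_nth_Abs add.assoc)
  show "f + g = g + f"
    by (simp only: plus_mfps_def add.commute)
  show "0 + f = f"
    by (rule mfps_eqI) (simp only: plus_mfps_def zero_mfps_def mfps_nth_Abs add_0_left)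
  show "- f + f = 0"
    by (simp only: plus_mfps_def uminus_mfps_def zero_mfps_def mfps_nth_Abs left_minus)
  show "f - g = f + - g"
    by (simp only: plus_mfps_def uminus_mfps_def minus_mfps_def mfps_nth_Abs diff_conv_add_uminus)
  have "mfps_nth (0 :: ('a, 'b) mfps) 0 \<noteq> mfps_nth (1 :: ('a, 'b) mfps) 0"
    by (simp add: zero_mfps_def one_mfps_def)
  then show "(0 :: ('a, 'b) mfps) \<noteq> 1" by (rule contrapos_nn) (rule arg_cong)
qed

end

definition mfps_const :: "'a::zero \<Rightarrow> ('a, 'n::finite) mfps"
  where "mfps_const c = Abs_mfps (\<lambda>\<alpha>. if \<alpha> = 0 then c else 0)"

definition mfps_X :: "'n::finite \<Rightarrow> ('a::zero_neq_one, 'n) mfps"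
  where "mfps_X i = Abs_mfps (\<lambda>\<alpha>. if \<alpha> = axis i 1 then 1 else 0)"

definition mfps_pderiv :: "'n::finite \<Rightarrow> ('a::semiring_1, 'n) mfps \<Rightarrow> ('a, 'n) mfps"
  where "mfps_pderiv i f = Abs_mfps (\<lambda>\<alpha>. of_nat (\<alpha> $ i + 1) * mfps_nth f (\<alpha> + axis i 1))"

text \<open>
  Substitution \<open>f(g) = \<Sum>\<^sub>\<alpha> f\<^sub>\<alpha> g\<^sup>\<alpha>\<close>, for \<open>g\<close> without constant term: then \<open>g\<^sup>\<alpha>\<close> has order at least
  \<open>|\<alpha>|\<close>, so only the \<open>\<alpha>\<close> with \<open>|\<alpha>| \<le> |\<beta>|\<close> contribute to the coefficient of \<open>z\<^sup>\<beta>\<close>.  The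
  definition is not meaningful if \<open>g\<close> has a constant term.
\<close>

definition mfps_compose ::
    "('a::comm_ring_1, 'n::finite) mfps \<Rightarrow> ('a, 'n) mfps ^ 'n \<Rightarrow> ('a, 'n) mfps"
  where "mfps_compose f g =
    Abs_mfps (\<lambda>\<beta>. \<Sum>\<alpha> | \<bar>\<alpha>\<bar>\<^sub>m \<le> \<bar>\<beta>\<bar>\<^sub>m. mfps_nth f \<alpha> * mfps_nth (mpow g \<alpha>) \<beta>)"


section \<open>The space \<open>V = \<complex>\<^sup>n[[z\<^sub>1, \<dots>, z\<^sub>n]]\<close>\<close>

text \<open>An element of \<open>V\<close> is represented by the vector of its \<open>n\<close> scalar component series.\<close>

type_synonym 'n vfps = "(complex, 'n) mfps ^ 'n"

definition vcoeff :: "'n::finite vfps \<Rightarrow> nat ^ 'n \<Rightarrow> complex ^ 'n"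
  where "vcoeff f \<alpha> = (\<chi> j. mfps_nth (f $ j) \<alpha>)"

definition valuation :: "'n::finite vfps \<Rightarrow> enat"
  where "valuation f = (INF \<alpha> \<in> {\<alpha>. vcoeff f \<alpha> \<noteq> 0}. enat \<bar>\<alpha>\<bar>\<^sub>m)"

definition V_space :: "nat \<Rightarrow> 'n::finite vfps set"
  where "V_space j = {f. valuation f > enat j}"

definition vid :: "'n::finite vfps"
  where "vid = (\<chi> j. mfps_X j)"

definition vcompose :: "'n::finite vfps \<Rightarrow> 'n vfps \<Rightarrow> 'n vfps"
  where "vcompose f g = (\<chi> j. mfps_compose (f $ j) g)"

definition mat_apply :: "complex ^ 'n ^ 'n \<Rightarrow> 'n::finite vfps \<Rightarrow> 'n vfps"
  where "mat_apply A g = (\<chi> i j. mfps_const (A $ i $ j)) *v g"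


section \<open>Non-resonance, linearization, small divisors\<close>

definition diag_mat :: "complex ^ 'n \<Rightarrow> complex ^ 'n ^ 'n"
  where "diag_mat \<omega> = (\<chi> i j. if i = j then \<omega> $ i else 0)"

text \<open>All components are non-negative, except at most one, which may be \<open>-1\<close>.\<close>

definition admissible :: "int ^ 'n \<Rightarrow> bool"
  where "admissible \<alpha> \<longleftrightarrow> (\<exists>j. \<alpha> $ j \<ge> -1 \<and> (\<forall>i. i \<noteq> j \<longrightarrow> \<alpha> $ i \<ge> 0))"

definition idot :: "int ^ 'n \<Rightarrow> complex ^ 'n \<Rightarrow> complex"
  where "idot \<alpha> \<omega> = (\<Sum>i\<in>UNIV. of_int (\<alpha> $ i) * \<omega> $ i)"

definition resonant :: "complex ^ 'n \<Rightarrow> bool"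
  where "resonant \<omega> \<longleftrightarrow> (\<exists>\<alpha> j. admissible \<alpha> \<and> \<bar>\<alpha>\<bar>\<^sub>m \<ge> 2 \<and> idot \<alpha> \<omega> - \<omega> $ j = 0)"

definition is_linearization :: "complex ^ 'n ^ 'n \<Rightarrow> 'n::finite vfps \<Rightarrow> 'n vfps \<Rightarrow> bool"
  where "is_linearization A f h \<longleftrightarrow> h \<in> V_space 1 \<and>
    (\<chi> j. \<Sum>i\<in>UNIV. mat_apply A vid $ i * mfps_pderiv i (h $ j)) - mat_apply A h
      = vcompose f (vid + h)"

definition linearization :: "complex ^ 'n ^ 'n \<Rightarrow> 'n::finite vfps \<Rightarrow> 'n vfps"
  where "linearization A f = (THE h. is_linearization A f h)"

definition Omega_hat :: "complex ^ 'n \<Rightarrow> nat \<Rightarrow> real"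
  where "Omega_hat \<omega> p =
    Min {cmod (idot \<alpha> \<omega>) | \<alpha>. admissible \<alpha> \<and> idot \<alpha> \<omega> \<noteq> 0 \<and> 0 < \<bar>\<alpha>\<bar>\<^sub>m \<and> \<bar>\<alpha>\<bar>\<^sub>m < int p}"

definition index_seq :: "(nat \<Rightarrow> nat) \<Rightarrow> bool"
  where "index_seq p \<longleftrightarrow> strict_mono p \<and> p 0 > 0"

definition Bruno_term :: "complex ^ 'n \<Rightarrow> (nat \<Rightarrow> nat) \<Rightarrow> nat \<Rightarrow> real"
  where "Bruno_term \<omega> p k = ln (inverse (Omega_hat \<omega> (p (k + 1)))) / real (p k)"

text \<open>
  The series is taken in the extended reals: as \<^const>\<open>Omega_hat\<close> is decreasing in \<open>p\<close>, its terms
  have eventually constant sign, so the sum always exists, but it may be \<open>-\<infinity>\<close>.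
\<close>

definition Bruno_condition :: "complex ^ 'n \<Rightarrow> (nat \<Rightarrow> nat) \<Rightarrow> bool"
  where "Bruno_condition \<omega> p \<longleftrightarrow> (\<Sum>k. ereal (Bruno_term \<omega> p k)) < \<infinity>"

definition kappa :: "(nat \<Rightarrow> nat) \<Rightarrow> nat ^ 'n \<Rightarrow> nat"
  where "kappa p \<alpha> = (THE k. p k \<le> \<bar>\<alpha>\<bar>\<^sub>m \<and> \<bar>\<alpha>\<bar>\<^sub>m < p (k + 1))"

definition at_infinite_degree :: "(nat ^ 'n) filter"
  where "at_infinite_degree = filtercomap mdeg at_top"


section \<open>The classes \<open>\<C>\<^sub>(M\<^sub>k\<^sub>)\<close>\<close>

text \<open>Sequences \<open>(M\<^sub>k)\<close> are indexed by \<open>k \<ge> 1\<close>; the value at \<open>0\<close> is irrelevant.\<close>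

definition weight_seq :: "(nat \<Rightarrow> real) \<Rightarrow> bool"
  where "weight_seq M \<longleftrightarrow>
    (\<forall>k\<ge>1. M k > 0) \<and>
    (INF k\<in>{1..}. M k powr (1 / real k)) > 0 \<and>
    (\<exists>C\<^sub>1>0. \<forall>k\<ge>1. M (k + 1) \<le> C\<^sub>1 ^ (k + 1) * M k) \<and>
    (\<forall>k\<ge>1. M (k + 1) ^ 2 \<le> M k * M (k + 2)) \<and>
    (\<forall>k\<ge>1. \<forall>l\<ge>1. M k * M l \<le> M (k + l - 1))"

definition growth_class :: "(nat \<Rightarrow> real) \<Rightarrow> 'n::finite vfps set"
  where "growth_class M = {f. \<exists>A>0. \<exists>B>0. \<forall>\<alpha>. \<bar>\<alpha>\<bar>\<^sub>m \<ge> 1 \<longrightarrow>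
    norm (vcoeff f \<alpha>) \<le> A * B ^ \<bar>\<alpha>\<bar>\<^sub>m * M \<bar>\<alpha>\<bar>\<^sub>m}"


section \<open>Germs of analytic diffeomorphisms\<close>

definition has_power_series_at ::
    "(complex ^ 'n \<Rightarrow> complex ^ 'n) \<Rightarrow> 'n::finite vfps \<Rightarrow> complex ^ 'n \<Rightarrow> bool"
  where "has_power_series_at G f a \<longleftrightarrow>
    (\<exists>r>0. \<forall>z\<in>ball a r. ((\<lambda>\<alpha>. mpow (z - a) \<alpha> *s vcoeff f \<alpha>) has_sum G z) UNIV)"

definition mv_analytic_on ::
    "(complex ^ 'n \<Rightarrow> complex ^ 'n::finite) \<Rightarrow> (complex ^ 'n) set \<Rightarrow> bool"
  where "mv_analytic_on G S \<longleftrightarrow> (\<forall>a\<in>S. \<exists>f. has_power_series_at G f a)"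

text \<open>
  The formal series \<open>F\<close> is the expansion at \<open>0\<close> of a bianalytic bijection, fixing \<open>0\<close>, between
  open neighbourhoods of \<open>0\<close>.
\<close>

definition germ_analytic_diffeo :: "'n::finite vfps \<Rightarrow> bool"
  where "germ_analytic_diffeo F \<longleftrightarrow> (\<exists>G H S T.
    open S \<and> open T \<and> 0 \<in> S \<and> 0 \<in> T \<and> G 0 = 0 \<and> homeomorphism S T G H \<and>
    mv_analytic_on G S \<and> mv_analytic_on H T \<and> has_power_series_at G F 0)"

end

theory Submission
  imports Defs
begin

text \<open>
  The homological operator \<open>h \<mapsto> \<Sum>\<^sub>i \<omega>\<^sub>i w\<^sub>i \<partial>\<^sub>i h - A h\<close> is diagonal: it multiplies the coefficient of
  \<open>w\<^sup>\<alpha>\<close> in component \<open>j\<close> by the divisor \<open>\<omega> \<cdot> \<alpha> - \<omega>\<^sub>j\<close>, which is nonzero for \<open>|\<alpha>| \<ge> 2\<close> by non-resonance.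
  As \<open>f\<close> has order at least two, the coefficients of \<open>f(w + h(w))\<close> of degree \<open>d\<close> involve only those of
  \<open>h\<close> of degree less than \<open>d\<close>.  So the linearization equation is a triangular recursion, with exactly
  one solution \<open>h\<close> (\<open>linearization_is_linearization\<close>), the degree-wise limit of the iterates of
  \<open>linearization_step\<close> from 0.

  Unfolding the recursion writes a coefficient of \<open>h\<close> as a sum over trees.  An internal node with \<open>s\<close>
  children carries a coefficient of \<open>f\<close> of degree \<open>s\<close>, hence a factor \<open>A B\<^sup>s M\<^sub>s\<close>, and an inverse
  divisor.  Three effects have to be controlled.

  \<^item> The number of trees: the series with coefficients \<open>c K\<^bsup>|\<alpha>|\<^esup> \<Prod>\<^sub>i (\<alpha>\<^sub>i + 1)\<^sup>-\<^sup>2\<close> reproduces itself under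
    \<open>s\<close>-fold products up to \<open>(16\<^sup>n c)\<^sup>s\<^sup>-\<^sup>1\<close>, which is small for small \<open>c\<close>.
  \<^item> The weights: \<open>M\<^sub>k M\<^sub>l \<le> M\<^sub>k\<^sub>+\<^sub>l\<^sub>-\<^sub>1\<close> yields \<open>M\<^sub>s M\<^bsub>d(1)\<^esub> \<cdots> M\<^bsub>d(s)\<^esub> \<le> M\<^bsub>d(1) + \<cdots> + d(s)\<^esub>\<close>, so the weights of a
    node and of its subtrees merge into the weight of the total degree.
  \<^item> The divisors: if those at \<open>\<nu>\<close> and \<open>\<nu> + \<rho>\<close> are both below \<open>\<Omega>(p) / 2\<close>, where \<open>\<Omega>\<close> stands for
    \<^const>\<open>Omega_hat\<close> and \<open>\<rho> \<noteq> 0\<close>, then their difference is a divisor too, so \<open>|\<rho>| \<ge> p\<close>.  Thus such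
    nodes are sparse, and a tree of degree \<open>\<alpha>\<close> has at most \<open>2 |\<alpha>| / p\<close> of them
    (\<open>forest_near_resonant_count\<close>).

  The first two points and the weight of the worst tree give \<open>linearization_forest_bound\<close>.  The
  third, for the thresholds \<open>p\<^sub>0 < p\<^sub>1 < \<dots>\<close>, bounds the product of the inverse divisors of a tree by
  \<open>C\<^bsup>|\<alpha>|\<^esup> exp (2 |\<alpha>| \<Sum>\<^sub>m\<^sub>\<le>\<^sub>\<kappa> max 0 b\<^sub>m)\<close>, where \<open>b\<^sub>m = log \<Omega>\<^sup>-\<^sup>1(p\<^sub>m\<^sub>+\<^sub>1) / p\<^sub>m\<close> and \<open>\<kappa> = \<kappa>(\<alpha>)\<close>
  (\<open>forest_weight_Bruno_bound\<close>).  This is the origin of the factor 2 in the hypotheses on the upper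
  limits.  Hence \<open>h\<close> lies in the class of \<open>N\<close> as soon as \<open>M\<close> times this exponential is at most \<open>N\<close> up
  to a geometric factor.  Under the Bruno condition this holds with \<open>N = M\<close>; under the conditions on
  the upper limits it holds for the given \<open>N\<close>, where \<open>M = 1\<close> in the analytic case.
\<close>

section \<open>Multi-indices\<close>

lemma mdeg_add: "\<bar>\<alpha> + \<beta>\<bar>\<^sub>m = \<bar>\<alpha>\<bar>\<^sub>m + \<bar>\<beta>\<bar>\<^sub>m"
  by (simp add: mdeg_def sum.distrib)

lemma mdeg_axis: "\<bar>axis i c\<bar>\<^sub>m = c"
  by (simp add: mdeg_def axis_def)

lemma mdeg_eq_0_iff: "\<bar>\<alpha>\<bar>\<^sub>m = 0 \<longleftrightarrow> \<alpha> = (0 :: nat ^ 'n)"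
  by (simp add: mdeg_def vec_eq_iff)

lemma mindex_split:
  fixes \<alpha> :: "nat ^ 'n"
  assumes "\<alpha> $ i > 0"
  obtains \<beta> where "\<alpha> = \<beta> + axis i 1"
proof
  show "\<alpha> = (\<chi> k. if k = i then \<alpha> $ k - 1 else \<alpha> $ k) + axis i 1"
    using assms by (auto simp: vec_eq_iff axis_def)
qed

lemma mindex_induct [consumes 1, case_names axis add]:
  fixes \<beta> :: "nat ^ 'n"
  assumes "\<beta> \<noteq> 0"
    and "\<And>i. P (axis i 1)"
    and "\<And>\<beta> i. \<beta> \<noteq> 0 \<Longrightarrow> P \<beta> \<Longrightarrow> P (\<beta> + axis i 1)"
  shows "P \<beta>"
  using assms(1)
proof (induction "\<bar>\<beta>\<bar>\<^sub>m" arbitrary: \<beta>)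
  case 0
  then show ?case by (simp add: mdeg_eq_0_iff)
next
  case (Suc k)
  from \<open>\<beta> \<noteq> 0\<close> obtain i where "\<beta> $ i > 0"
    by (auto simp: vec_eq_iff)
  then obtain \<beta>' where \<beta>: "\<beta> = \<beta>' + axis i 1"
    by (rule mindex_split)
  show ?case
  proof (cases "\<beta>' = 0")
    case True
    with \<beta> assms(2) show ?thesis by simp
  next
    case False
    moreover have "k = \<bar>\<beta>'\<bar>\<^sub>m"
      using Suc.hyps(2) by (simp add: \<beta> mdeg_add mdeg_axis)
    ultimately show ?thesis
      using Suc.hyps(1) assms(3) \<beta> by blast
  qed
qed

lemma mpow_axis: "mpow z (axis i 1) = z $ i"
proof -
  have "mpow z (axis i 1) = (\<Prod>k\<in>UNIV. if k = i then z $ k else 1)"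
    unfolding mpow_def by (rule prod.cong) (auto simp: axis_def)
  then show ?thesis by simp
qed

lemma mpow_add: "mpow z (\<alpha> + \<beta>) = mpow z \<alpha> * mpow z \<beta>"
  by (simp add: mpow_def power_add prod.distrib)

lemma sum_mindex_prod:
  fixes f :: "'n::finite \<Rightarrow> nat \<Rightarrow> 'a::comm_semiring_1"
  assumes "\<And>i. finite (S i)"
  shows "(\<Sum>\<alpha> | \<forall>i. \<alpha> $ i \<in> S i. \<Prod>i\<in>UNIV. f i (\<alpha> $ i)) = (\<Prod>i\<in>UNIV. \<Sum>k\<in>S i. f i k)"
proof -
  have "(\<Prod>i\<in>UNIV. \<Sum>k\<in>S i. f i k) = (\<Sum>g\<in>Pi\<^sub>E UNIV S. \<Prod>i\<in>UNIV. f i (g i))"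
    by (rule prod_sum_PiE) (use assms in auto)
  also have "\<dots> = (\<Sum>\<alpha> | \<forall>i. \<alpha> $ i \<in> S i. \<Prod>i\<in>UNIV. f i (\<alpha> $ i))"
    by (rule sum.reindex_bij_witness[where i="vec_nth" and j="vec_lambda"])
       (auto simp: PiE_UNIV_domain)
  finally show ?thesis by simp
qed

lemma mindex_decomp_sum:
  "(\<Sum>(\<alpha>, \<beta>) \<in> {(\<alpha>, \<beta>). \<alpha> + \<beta> = (\<gamma> :: nat ^ 'n)}. F \<alpha> \<beta>)
    = (\<Sum>\<alpha> | \<forall>i. \<alpha> $ i \<in> {..\<gamma> $ i}. F \<alpha> (\<gamma> - \<alpha>))"
proof (rule sum.reindex_bij_witness[where i="\<lambda>\<alpha>. (\<alpha>, \<gamma> - \<alpha>)" and j=fst])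
  fix x assume "x \<in> {(\<alpha>, \<beta>). \<alpha> + \<beta> = \<gamma>}"
  then have *: "\<gamma> = fst x + snd x" by auto
  then have "\<gamma> - fst x = snd x" by (simp add: vec_eq_iff)
  then show "(fst x, \<gamma> - fst x) = x" "F (fst x) (\<gamma> - fst x) = (case x of (\<alpha>, \<beta>) \<Rightarrow> F \<alpha> \<beta>)"
    by (simp_all add: case_prod_unfold)
  show "fst x \<in> {\<alpha>. \<forall>i. \<alpha> $ i \<in> {..\<gamma> $ i}}" by (simp add: *)
qed (auto simp: vec_eq_iff)

text \<open>
  The finite sum is dominated by the sum over a box, which factors into \<open>n\<close> geometric sums.
\<close>

lemma sum_power_mdeg_le:
  fixes x :: real
  assumes "0 \<le> x" "x < 1"
  shows "(\<Sum>\<beta> :: nat ^ 'n | \<bar>\<beta>\<bar>\<^sub>m \<le> d. x ^ \<bar>\<beta>\<bar>\<^sub>m) \<le> (1 / (1 - x)) ^ CARD('n)"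
proof -
  have "\<beta> $ i \<le> \<bar>\<beta>\<bar>\<^sub>m" for \<beta> :: "nat ^ 'n" and i
    unfolding mdeg_def by (rule member_le_sum) simp_all
  then have sub: "{\<beta> :: nat ^ 'n. \<bar>\<beta>\<bar>\<^sub>m \<le> d} \<subseteq> {\<beta>. \<forall>i. \<beta> $ i \<in> {..d}}"
    by (auto intro: order_trans)
  have fin: "finite {\<beta> :: nat ^ 'n. \<forall>i. \<beta> $ i \<in> {..d}}"
    using finite_mindex_le[of "\<chi> i. d"] by simp
  have "(\<Sum>\<beta> :: nat ^ 'n | \<bar>\<beta>\<bar>\<^sub>m \<le> d. x ^ \<bar>\<beta>\<bar>\<^sub>m) \<le> (\<Sum>\<beta> :: nat ^ 'n | \<forall>i. \<beta> $ i \<in> {..d}. x ^ \<bar>\<beta>\<bar>\<^sub>m)"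
    by (rule sum_mono2[OF fin sub]) (simp add: assms)
  also have "\<dots> = (\<Sum>\<beta> :: nat ^ 'n | \<forall>i. \<beta> $ i \<in> {..d}. \<Prod>i\<in>UNIV. x ^ (\<beta> $ i))"
    by (simp add: mdeg_def power_sum)
  also have "\<dots> = (\<Prod>i\<in>(UNIV :: 'n set). \<Sum>k\<in>{..d}. x ^ k)"
    by (rule sum_mindex_prod) simp
  also have "\<dots> \<le> (1 / (1 - x)) ^ CARD('n)"
  proof -
    have "(\<Sum>k\<le>d. x ^ k) \<le> (\<Sum>k. x ^ k)"
      by (rule sum_le_suminf) (use assms in \<open>auto intro: summable_geometric\<close>)
    then have "(\<Sum>k\<le>d. x ^ k) \<le> 1 / (1 - x)"
      using assms by (simp add: suminf_geometric)
    then show ?thesis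
      by (simp add: power_mono sum_nonneg assms)
  qed
  finally show ?thesis .
qed


section \<open>A decay factor stable under convolution\<close>

lemma sum_inverse_squares_le: "(\<Sum>a\<le>m. 1 / (real a + 1)\<^sup>2) \<le> 2 - 1 / (real m + 1)"
proof (induction m)
  case (Suc m)
  have "1 / (real m + 2)\<^sup>2 \<le> 1 / (real m + 1) - 1 / (real m + 2)"
  proof -
    have "1 / (real m + 2)\<^sup>2 \<le> 1 / ((real m + 1) * (real m + 2))"
      unfolding power2_eq_square by (intro divide_left_mono mult_right_mono) auto
    also have "\<dots> = 1 / (real m + 1) - 1 / (real m + 2)"
      by (simp add: field_simps)
    finally show ?thesis .
  qed
  with Suc show ?case by (simp add: add.commute)
qed simp

text \<open>
  In each summand one of the two indices is at least \<open>m / 2\<close>, and its factor is at most four times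
  the value at \<open>m\<close>; the sum of the other factor over all indices is at most 2.
\<close>

lemma inverse_square_convolution:
  "(\<Sum>a\<le>m. 1 / (real a + 1)\<^sup>2 * (1 / (real (m - a) + 1)\<^sup>2)) \<le> 16 / (real m + 1)\<^sup>2"
proof -
  define v where "v a = 1 / (real a + 1)\<^sup>2" for a :: nat
  have v0: "v a \<ge> 0" for a by (simp add: v_def)
  have half: "v a \<le> 4 * v m" if "m \<le> 2 * a" for a
  proof -
    have "(real m + 1)\<^sup>2 \<le> (2 * (real a + 1))\<^sup>2"
      using that by (intro power_mono) auto
    then have "(real m + 1)\<^sup>2 \<le> 4 * (real a + 1)\<^sup>2"
      unfolding power_mult_distrib by simp
    then have "1 / (4 * (real a + 1)\<^sup>2) \<le> 1 / (real m + 1)\<^sup>2"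
      by (intro divide_left_mono) auto
    then show ?thesis
      by (simp add: v_def)
  qed
  have le: "v a * v (m - a) \<le> 4 * v m * v (m - a) + 4 * v m * v a" if "a \<le> m" for a
  proof (cases "m \<le> 2 * a")
    case True
    then have "v a * v (m - a) \<le> 4 * v m * v (m - a)"
      by (intro mult_right_mono half v0)
    then show ?thesis using v0[of a] v0[of m] by (smt (verit) mult_nonneg_nonneg)
  next
    case False
    then have "v a * v (m - a) \<le> v a * (4 * v m)"
      by (intro mult_left_mono half v0) auto
    then show ?thesis using v0[of "m - a"] v0[of m] by (smt (verit) mult_nonneg_nonneg mult.commute)
  qed
  have s: "(\<Sum>a\<le>m. v a) \<le> 2"
    using sum_inverse_squares_le[of m] unfolding v_def by (smt (verit) divide_nonneg_nonneg of_nat_0_le_iff)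
  have s': "(\<Sum>a\<le>m. v (m - a)) = (\<Sum>a\<le>m. v a)"
    by (rule sum.reindex_bij_witness[where i="\<lambda>a. m - a" and j="\<lambda>a. m - a"]) auto
  have "(\<Sum>a\<le>m. v a * v (m - a)) \<le> (\<Sum>a\<le>m. 4 * v m * v (m - a) + 4 * v m * v a)"
    by (rule sum_mono) (use le in auto)
  also have "\<dots> = 8 * v m * (\<Sum>a\<le>m. v a)"
    by (simp add: sum.distrib s' flip: sum_distrib_left)
  also have "\<dots> \<le> 8 * v m * 2"
    using v0 by (intro mult_left_mono s) auto
  finally show ?thesis by (simp add: v_def)
qed

text \<open>
  A majorant with coefficients \<open>c K\<^bsup>|\<alpha>|\<^esup>\<close> alone would not be stable under products, because the
  number of decompositions \<open>\<alpha> = \<beta> + \<gamma>\<close> grows with \<open>\<alpha>\<close>.  The following summable factor absorbs that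
  number into a constant, which makes explicit majorants available for power series that are
  defined by recursion.
\<close>

definition decay :: "nat ^ 'n \<Rightarrow> real"
  where "decay \<alpha> = (\<Prod>i\<in>UNIV. 1 / (real (\<alpha> $ i) + 1)\<^sup>2)"

lemma decay_pos: "decay \<alpha> > 0"
  by (auto simp: decay_def intro!: prod_pos)

lemma decay_le_1: "decay \<alpha> \<le> 1"
  unfolding decay_def by (rule prod_le_1) (auto simp: divide_le_eq_1)

lemma decay_axis: "decay (axis i 1 :: nat ^ 'n) = 1 / 4"
proof -
  have "decay (axis i 1 :: nat ^ 'n) = (\<Prod>k\<in>UNIV. if k = i then 1 / 4 else 1)"
    unfolding decay_def by (rule prod.cong) (auto simp: axis_def)
  then show ?thesis by simp
qed

lemma decay_convolution:
  "(\<Sum>(\<alpha>, \<beta>) \<in> {(\<alpha>, \<beta>). \<alpha> + \<beta> = (\<gamma> :: nat ^ 'n)}. decay \<alpha> * decay \<beta>) \<le> 16 ^ CARD('n) * decay \<gamma>"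
proof -
  have "(\<Sum>(\<alpha>, \<beta>) \<in> {(\<alpha>, \<beta>). \<alpha> + \<beta> = \<gamma>}. decay \<alpha> * decay \<beta>)
      = (\<Sum>\<alpha> | \<forall>i. \<alpha> $ i \<in> {..\<gamma> $ i}. \<Prod>i\<in>UNIV.
          1 / (real (\<alpha> $ i) + 1)\<^sup>2 * (1 / (real (\<gamma> $ i - \<alpha> $ i) + 1)\<^sup>2))"
    unfolding mindex_decomp_sum by (simp add: decay_def flip: prod.distrib)
  also have "\<dots> = (\<Prod>i\<in>UNIV. \<Sum>a\<le>\<gamma> $ i. 1 / (real a + 1)\<^sup>2 * (1 / (real (\<gamma> $ i - a) + 1)\<^sup>2))"
    by (rule sum_mindex_prod[where f="\<lambda>i a. 1 / (real a + 1)\<^sup>2 * (1 / (real (\<gamma> $ i - a) + 1)\<^sup>2)"]) simp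
  also have "\<dots> \<le> (\<Prod>i\<in>UNIV. 16 / (real (\<gamma> $ i) + 1)\<^sup>2)"
    by (intro prod_mono conjI inverse_square_convolution sum_nonneg) simp
  also have "\<dots> = 16 ^ CARD('n) * decay \<gamma>"
    by (simp add: decay_def prod_dividef)
  finally show ?thesis .
qed


section \<open>Coefficients of formal power series\<close>

lemma mfps_nth_mult:
  "mfps_nth (f * g) \<gamma> = (\<Sum>(\<alpha>, \<beta>) \<in> {(\<alpha>, \<beta>). \<alpha> + \<beta> = \<gamma>}. mfps_nth f \<alpha> * mfps_nth g \<beta>)"
  by (simp add: times_mfps_def)

lemma mfps_nth_add: "mfps_nth (f + g) \<alpha> = mfps_nth f \<alpha> + mfps_nth g \<alpha>"
  by (simp add: plus_mfps_def)

lemma mfps_nth_diff: "mfps_nth (f - g) \<alpha> = mfps_nth f \<alpha> - mfps_nth g \<alpha>"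
  by (simp add: minus_mfps_def)

lemma mfps_nth_sum: "mfps_nth (\<Sum>i\<in>I. f i) \<alpha> = (\<Sum>i\<in>I. mfps_nth (f i) \<alpha>)"
  by (induction I rule: infinite_finite_induct) (simp_all add: mfps_nth_add zero_mfps_def)

lemma mfps_nth_const_mult:
  fixes g :: "('a::comm_ring_1, 'n::finite) mfps"
  shows "mfps_nth (mfps_const c * g) \<alpha> = c * mfps_nth g \<alpha>"
proof -
  have "mfps_nth (mfps_const c * g) \<alpha>
      = (\<Sum>(\<beta>, \<gamma>) \<in> {(0 :: nat ^ 'n, \<alpha>)}. (if \<beta> = 0 then c else 0) * mfps_nth g \<gamma>)"
    unfolding mfps_nth_mult mfps_const_def mfps_nth_Abs
    by (rule sum.mono_neutral_right) (auto simp: finite_mindex_decomp split: if_splits)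
  then show ?thesis by simp
qed

lemma mfps_nth_X_mult_pderiv:
  fixes g :: "('a::comm_ring_1, 'n::finite) mfps"
  shows "mfps_nth (mfps_X i * mfps_pderiv i g) \<alpha> = of_nat (\<alpha> $ i) * mfps_nth g \<alpha>"
proof (cases "\<alpha> $ i")
  case 0
  have "(\<Sum>(\<beta>, \<gamma>) \<in> {(\<beta>, \<gamma>). \<beta> + \<gamma> = \<alpha>}.
      (if \<beta> = axis i 1 then 1 else 0) * mfps_nth (mfps_pderiv i g) \<gamma>) = 0"
    by (rule sum.neutral) (use 0 in auto)
  then show ?thesis
    by (simp add: mfps_nth_mult mfps_X_def 0)
next
  case (Suc k)
  then obtain \<alpha>' where \<alpha>: "\<alpha> = \<alpha>' + axis i 1"
    using mindex_split[of \<alpha> i] by auto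
  have "mfps_nth (mfps_X i * mfps_pderiv i g) \<alpha>
      = (\<Sum>(\<beta>, \<gamma>) \<in> {(axis i 1 :: nat ^ 'n, \<alpha>')}.
          (if \<beta> = axis i 1 then 1 else 0) * mfps_nth (mfps_pderiv i g) \<gamma>)"
    unfolding mfps_nth_mult mfps_X_def mfps_nth_Abs
    by (rule sum.mono_neutral_right)
       (auto simp: finite_mindex_decomp \<alpha> add.commute split: if_splits)
  then show ?thesis
    by (simp add: mfps_pderiv_def \<alpha>)
qed

lemma mpow_nth_eq_0:
  assumes "\<And>i. mfps_nth (g $ i) 0 = 0" and "\<bar>\<alpha>\<bar>\<^sub>m < \<bar>\<beta>\<bar>\<^sub>m"
  shows "mfps_nth (mpow (g :: ('a::comm_ring_1, 'n::finite) mfps ^ 'n) \<beta>) \<alpha> = 0"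
proof -
  have "\<beta> \<noteq> 0" using assms(2) by (auto simp flip: mdeg_eq_0_iff)
  then show ?thesis
    using assms(2)
  proof (induction \<beta> arbitrary: \<alpha> rule: mindex_induct)
    case (axis i)
    then have "\<alpha> = 0" by (simp add: mdeg_axis mdeg_eq_0_iff)
    with assms(1) show ?case by (simp add: mpow_axis del: One_nat_def)
  next
    case (add \<beta> i)
    have "mfps_nth (mpow g \<beta>) \<gamma> * mfps_nth (g $ i) \<epsilon> = 0" if "\<gamma> + \<epsilon> = \<alpha>" for \<gamma> \<epsilon>
    proof (cases "\<epsilon> = 0")
      case True
      with assms(1) show ?thesis by simp
    next
      case False
      then have "\<bar>\<gamma>\<bar>\<^sub>m < \<bar>\<beta>\<bar>\<^sub>m"
        using that add.prems by (auto simp: mdeg_add mdeg_axis simp flip: mdeg_eq_0_iff)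
      with add.IH show ?thesis by simp
    qed
    then show ?case
      by (auto simp: mpow_add mpow_axis mfps_nth_mult simp del: One_nat_def intro!: sum.neutral)
  qed
qed

text \<open>
  Each factor of \<open>g\<^sup>\<beta>\<close> has order at least one, so in a product of \<open>|\<beta>|\<close> coefficients of total degree
  \<open>|\<alpha>|\<close> none has degree above \<open>|\<alpha>| - |\<beta>| + 1\<close>.
\<close>

lemma mpow_nth_cong:
  fixes g g' :: "('a::comm_ring_1, 'n::finite) mfps ^ 'n"
  assumes "\<And>i. mfps_nth (g $ i) 0 = 0" and "\<And>i. mfps_nth (g' $ i) 0 = 0"
    and agree: "\<And>i \<alpha>. \<bar>\<alpha>\<bar>\<^sub>m < d \<Longrightarrow> mfps_nth (g $ i) \<alpha> = mfps_nth (g' $ i) \<alpha>"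
    and "\<beta> \<noteq> 0" and "\<bar>\<alpha>\<bar>\<^sub>m + 1 < d + \<bar>\<beta>\<bar>\<^sub>m"
  shows "mfps_nth (mpow g \<beta>) \<alpha> = mfps_nth (mpow g' \<beta>) \<alpha>"
  using assms(4,5)
proof (induction \<beta> arbitrary: \<alpha> rule: mindex_induct)
  case (axis i)
  then show ?case using agree by (simp add: mpow_axis mdeg_axis del: One_nat_def)
next
  case (add \<beta> i)
  have "mfps_nth (mpow g \<beta>) \<gamma> * mfps_nth (g $ i) \<epsilon> = mfps_nth (mpow g' \<beta>) \<gamma> * mfps_nth (g' $ i) \<epsilon>"
    if "\<gamma> + \<epsilon> = \<alpha>" for \<gamma> \<epsilon>
  \<comment> \<open>Either a factor vanishes by its order, or both factors have degrees low enough to agree.\<close>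
  proof (cases "\<epsilon> = 0 \<or> \<bar>\<gamma>\<bar>\<^sub>m < \<bar>\<beta>\<bar>\<^sub>m")
    case True
    then show ?thesis
      using assms(1,2) by (auto simp: mpow_nth_eq_0)
  next
    case False
    then have "\<bar>\<epsilon>\<bar>\<^sub>m < d" "\<bar>\<gamma>\<bar>\<^sub>m + 1 < d + \<bar>\<beta>\<bar>\<^sub>m"
      using that add.prems by (auto simp: mdeg_add mdeg_axis simp flip: mdeg_eq_0_iff)
    with add.IH agree show ?thesis by simp
  qed
  then show ?case
    by (auto simp: mpow_add mpow_axis mfps_nth_mult simp del: One_nat_def intro!: sum.cong)
qed

lemma vfps_eq_iff: "f = g \<longleftrightarrow> (\<forall>j \<alpha>. mfps_nth (f $ j) \<alpha> = mfps_nth (g $ j) \<alpha>)"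
  by (auto simp: vec_eq_iff intro: mfps_eqI)

lemma V_space_iff: "f \<in> V_space k \<longleftrightarrow> (\<forall>\<alpha> j. \<bar>\<alpha>\<bar>\<^sub>m \<le> k \<longrightarrow> mfps_nth (f $ j) \<alpha> = 0)"
proof -
  have "f \<in> V_space k \<longleftrightarrow> enat (Suc k) \<le> valuation f"
    by (simp add: V_space_def Suc_ile_eq)
  also have "\<dots> \<longleftrightarrow> (\<forall>\<alpha>. vcoeff f \<alpha> \<noteq> 0 \<longrightarrow> k < \<bar>\<alpha>\<bar>\<^sub>m)"
    by (auto simp: valuation_def le_INF_iff Suc_le_eq)
  also have "\<dots> \<longleftrightarrow> (\<forall>\<alpha> j. \<bar>\<alpha>\<bar>\<^sub>m \<le> k \<longrightarrow> mfps_nth (f $ j) \<alpha> = 0)"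
    by (auto simp: vcoeff_def vec_eq_iff not_less[symmetric])
  finally show ?thesis .
qed

lemma mfps_nth_vcompose:
  "mfps_nth (vcompose f g $ j) \<alpha>
    = (\<Sum>\<beta> | \<bar>\<beta>\<bar>\<^sub>m \<le> \<bar>\<alpha>\<bar>\<^sub>m. mfps_nth (f $ j) \<beta> * mfps_nth (mpow g \<beta>) \<alpha>)"
  by (simp add: vcompose_def mfps_compose_def)

text \<open>
  The gain of one degree, from below \<open>d\<close> to \<open>d\<close>, comes from the order of \<open>f\<close>, which is at least two.
  It makes the linearization equation triangular.
\<close>

lemma vcompose_nth_cong:
  assumes "f \<in> V_space 1"
    and "\<And>i. mfps_nth (g $ i) 0 = 0" and "\<And>i. mfps_nth (g' $ i) 0 = 0"
    and "\<And>i \<alpha>. \<bar>\<alpha>\<bar>\<^sub>m < d \<Longrightarrow> mfps_nth (g $ i) \<alpha> = mfps_nth (g' $ i) \<alpha>"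
    and "\<bar>\<alpha>\<bar>\<^sub>m \<le> d"
  shows "mfps_nth (vcompose f g $ j) \<alpha> = mfps_nth (vcompose f g' $ j) \<alpha>"
  unfolding mfps_nth_vcompose
proof (rule sum.cong[OF refl])
  fix \<beta> :: "nat ^ 'a"
  show "mfps_nth (f $ j) \<beta> * mfps_nth (mpow g \<beta>) \<alpha> = mfps_nth (f $ j) \<beta> * mfps_nth (mpow g' \<beta>) \<alpha>"
  proof (cases "\<bar>\<beta>\<bar>\<^sub>m \<le> 1")
    case True
    with assms(1) show ?thesis by (simp add: V_space_iff)
  next
    case False
    then have "\<beta> \<noteq> 0" by (auto simp flip: mdeg_eq_0_iff)
    then have "mfps_nth (mpow g \<beta>) \<alpha> = mfps_nth (mpow g' \<beta>) \<alpha>"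
      by (intro mpow_nth_cong[where d=d] assms(2-4)) (use False assms(5) in auto)
    then show ?thesis by simp
  qed
qed


section \<open>The linearization as a fixed point\<close>

definition small_divisor :: "complex ^ 'n \<Rightarrow> 'n \<Rightarrow> nat ^ 'n \<Rightarrow> complex"
  where "small_divisor \<omega> j \<alpha> = idot (\<chi> i. int (\<alpha> $ i)) \<omega> - \<omega> $ j"

lemma small_divisor_nonzero:
  assumes "\<not> resonant \<omega>" "\<bar>\<alpha>\<bar>\<^sub>m \<ge> 2"
  shows "small_divisor \<omega> j \<alpha> \<noteq> 0"
proof -
  have "\<bar>\<chi> i. int (\<alpha> $ i)\<bar>\<^sub>m = int \<bar>\<alpha>\<bar>\<^sub>m"
    by (simp add: mdeg_def)
  moreover have "admissible (\<chi> i. int (\<alpha> $ i))"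
    by (simp add: admissible_def order_trans[of "-1" 0])
  ultimately show ?thesis
    using assms by (fastforce simp: small_divisor_def resonant_def)
qed

text \<open>
  The right-hand side of the linearization equation, divided by the eigenvalues of the homological
  operator.  Coefficients of degree at most one are set to 0: the divisor
  \<open>\<omega> \<cdot> e\<^sub>j - \<omega>\<^sub>j\<close> vanishes there.
\<close>

definition linearization_step :: "complex ^ 'n \<Rightarrow> 'n::finite vfps \<Rightarrow> 'n vfps \<Rightarrow> 'n vfps"
  where "linearization_step \<omega> f h = (\<chi> j. Abs_mfps (\<lambda>\<alpha>.
    if \<bar>\<alpha>\<bar>\<^sub>m \<ge> 2 then mfps_nth (vcompose f (vid + h) $ j) \<alpha> / small_divisor \<omega> j \<alpha> else 0))"

lemma mfps_const_0 [simp]: "mfps_const 0 = 0"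
  by (simp add: mfps_const_def zero_mfps_def)

lemma mat_apply_diag: "mat_apply (diag_mat \<omega>) g $ i = mfps_const (\<omega> $ i) * g $ i"
proof -
  have "(\<Sum>j\<in>UNIV. mfps_const (if i = j then \<omega> $ i else 0) * g $ j)
      = (\<Sum>j\<in>UNIV. if j = i then mfps_const (\<omega> $ i) * g $ i else 0)"
    by (rule sum.cong) auto
  then show ?thesis
    by (simp add: mat_apply_def matrix_vector_mult_def diag_mat_def)
qed

text \<open>
  Each monomial is an eigenvector of \<open>\<Sum>\<^sub>i \<omega>\<^sub>i w\<^sub>i \<partial>\<^sub>i\<close>, because \<open>w\<^sub>i \<partial>\<^sub>i\<close> multiplies \<open>w\<^sup>\<alpha>\<close> by \<open>\<alpha>\<^sub>i\<close>.
\<close>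

lemma homological_operator_nth:
  fixes h :: "'n::finite vfps"
  shows "mfps_nth (((\<chi> j. \<Sum>i\<in>UNIV. mat_apply (diag_mat \<omega>) vid $ i * mfps_pderiv i (h $ j))
      - mat_apply (diag_mat \<omega>) h) $ j) \<alpha> = small_divisor \<omega> j \<alpha> * mfps_nth (h $ j) \<alpha>"
proof -
  have "mfps_nth (mfps_const (\<omega> $ i) * mfps_X i * mfps_pderiv i (h $ j)) \<alpha>
      = of_nat (\<alpha> $ i) * \<omega> $ i * mfps_nth (h $ j) \<alpha>" for i
    by (simp add: mult.assoc mfps_nth_const_mult mfps_nth_X_mult_pderiv)
  then show ?thesis
    by (simp add: mfps_nth_diff mfps_nth_sum mat_apply_diag vid_def mfps_nth_const_mult
        small_divisor_def idot_def left_diff_distrib sum_distrib_right)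
qed

lemma is_linearization_iff:
  assumes "\<not> resonant \<omega>" and f: "f \<in> V_space 1"
  shows "is_linearization (diag_mat \<omega>) f h \<longleftrightarrow> h \<in> V_space 1 \<and> linearization_step \<omega> f h = h"
proof (cases "h \<in> V_space 1")
  case True
  have low: "mfps_nth (vcompose f g $ j) \<alpha> = 0" if "\<bar>\<alpha>\<bar>\<^sub>m < 2" for g \<alpha> j
    unfolding mfps_nth_vcompose
    by (rule sum.neutral) (use that f in \<open>auto simp: V_space_iff\<close>)
  have "is_linearization (diag_mat \<omega>) f h \<longleftrightarrow>
      (\<forall>j \<alpha>. small_divisor \<omega> j \<alpha> * mfps_nth (h $ j) \<alpha> = mfps_nth (vcompose f (vid + h) $ j) \<alpha>)"
    unfolding is_linearization_def vfps_eq_iff homological_operator_nth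
    using True by simp
  also have "\<dots> \<longleftrightarrow> (\<forall>j \<alpha>. mfps_nth (linearization_step \<omega> f h $ j) \<alpha> = mfps_nth (h $ j) \<alpha>)"
  proof (intro iff_allI)
    fix j and \<alpha> :: "nat ^ 'a"
    show "small_divisor \<omega> j \<alpha> * mfps_nth (h $ j) \<alpha> = mfps_nth (vcompose f (vid + h) $ j) \<alpha> \<longleftrightarrow>
        mfps_nth (linearization_step \<omega> f h $ j) \<alpha> = mfps_nth (h $ j) \<alpha>"
    proof (cases "\<bar>\<alpha>\<bar>\<^sub>m \<ge> 2")
      case ge: True
      then show ?thesis
        using small_divisor_nonzero[OF assms(1) ge, of j]
        by (auto simp: linearization_step_def field_simps)
    next
      case False
      then show ?thesis
        using True low by (simp add: linearization_step_def V_space_iff)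
    qed
  qed
  also have "\<dots> \<longleftrightarrow> linearization_step \<omega> f h = h"
    by (simp add: vfps_eq_iff)
  finally show ?thesis using True by simp
qed (simp add: is_linearization_def)

lemma linearization_step_in_V: "linearization_step \<omega> f h \<in> V_space 1"
  by (simp add: V_space_iff linearization_step_def)

lemma vid_add_nth_0: "h \<in> V_space 1 \<Longrightarrow> mfps_nth ((vid + h) $ i) 0 = 0"
proof -
  have "(0 :: nat ^ 'a) \<noteq> axis i 1" by (simp add: vec_eq_iff axis_def exI[of _ i])
  then show "h \<in> V_space 1 \<Longrightarrow> mfps_nth ((vid + h) $ i) 0 = 0"
    by (simp add: V_space_iff vid_def mfps_X_def mfps_nth_add mdeg_def)
qed

lemma linearization_step_cong:
  assumes "f \<in> V_space 1" "h \<in> V_space 1" "h' \<in> V_space 1"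
    and "\<And>j \<alpha>. \<bar>\<alpha>\<bar>\<^sub>m < d \<Longrightarrow> mfps_nth (h $ j) \<alpha> = mfps_nth (h' $ j) \<alpha>"
    and "\<bar>\<alpha>\<bar>\<^sub>m < Suc d"
  shows "mfps_nth (linearization_step \<omega> f h $ j) \<alpha> = mfps_nth (linearization_step \<omega> f h' $ j) \<alpha>"
proof -
  have "mfps_nth (vcompose f (vid + h) $ j) \<alpha> = mfps_nth (vcompose f (vid + h') $ j) \<alpha>"
    by (rule vcompose_nth_cong[where d=d])
       (use assms in \<open>auto simp: mfps_nth_add vid_add_nth_0 simp del: vector_add_component
         intro: vid_add_nth_0\<close>, simp add: mfps_nth_add)
  then show ?thesis by (simp add: linearization_step_def)
qed

text \<open>
  The step is contracting for the degree-wise topology, so its iterates from 0 stabilise: the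
  \<open>k\<close>-th iterate has the right coefficients in all degrees below \<open>k\<close>.  Besides existence and
  uniqueness of the linearization, this transfers to it every coefficient bound that the step
  preserves.
\<close>

abbreviation linearization_approx :: "complex ^ 'n \<Rightarrow> 'n::finite vfps \<Rightarrow> nat \<Rightarrow> 'n vfps"
  where "linearization_approx \<omega> f k \<equiv> (linearization_step \<omega> f ^^ k) 0"

lemma linearization_approx_in_V: "linearization_approx \<omega> f k \<in> V_space 1"
proof (cases k)
  case 0
  then show ?thesis by (simp add: V_space_iff zero_mfps_def)
next
  case (Suc l)
  then show ?thesis by (simp only: funpow.simps comp_apply linearization_step_in_V)
qed

lemma linearization_approx_stable:
  assumes "f \<in> V_space 1" "\<bar>\<alpha>\<bar>\<^sub>m < k"
  shows "mfps_nth (linearization_approx \<omega> f (k + l) $ j) \<alpha> = mfps_nth (linearization_approx \<omega> f k $ j) \<alpha>"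
  using assms(2)
proof (induction k arbitrary: \<alpha> j)
  case (Suc k)
  show ?case
    unfolding add_Suc funpow.simps comp_apply
    by (rule linearization_step_cong[OF assms(1) linearization_approx_in_V linearization_approx_in_V Suc.IH Suc.prems])
qed simp

lemma linearization_step_fixpoint_agrees_approx:
  assumes "f \<in> V_space 1" "h \<in> V_space 1" "linearization_step \<omega> f h = h" "\<bar>\<alpha>\<bar>\<^sub>m < k"
  shows "mfps_nth (h $ j) \<alpha> = mfps_nth (linearization_approx \<omega> f k $ j) \<alpha>"
  using assms(4)
proof (induction k arbitrary: \<alpha> j)
  case (Suc k)
  have "mfps_nth (linearization_step \<omega> f h $ j) \<alpha>
      = mfps_nth (linearization_step \<omega> f (linearization_approx \<omega> f k) $ j) \<alpha>"
    by (rule linearization_step_cong[OF assms(1,2) linearization_approx_in_V Suc.IH Suc.prems])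
  then show ?case by (simp add: assms(3))
qed simp

lemma linearization_is_linearization:
  assumes "\<not> resonant \<omega>" and f: "f \<in> V_space 1"
  shows "is_linearization (diag_mat \<omega>) f (linearization (diag_mat \<omega>) f)"
  unfolding linearization_def
proof (rule theI')
  define h where "h = (\<chi> j. Abs_mfps (\<lambda>\<alpha>. mfps_nth (linearization_approx \<omega> f (Suc \<bar>\<alpha>\<bar>\<^sub>m) $ j) \<alpha>))"
  have h: "mfps_nth (h $ j) \<alpha> = mfps_nth (linearization_approx \<omega> f k $ j) \<alpha>" if "\<bar>\<alpha>\<bar>\<^sub>m < k" for j \<alpha> k
    using linearization_approx_stable[OF f, where \<alpha>=\<alpha> and k="Suc \<bar>\<alpha>\<bar>\<^sub>m" and l="k - Suc \<bar>\<alpha>\<bar>\<^sub>m"] that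
    by (simp add: h_def del: funpow.simps)
  have V: "h \<in> V_space 1"
    using linearization_approx_in_V[where \<omega>=\<omega> and f=f] by (auto simp: h_def V_space_iff simp del: funpow.simps)
  have "linearization_step \<omega> f h = h"
  proof (intro vfps_eq_iff[THEN iffD2] allI)
    fix j \<alpha>
    have "mfps_nth (linearization_step \<omega> f h $ j) \<alpha>
        = mfps_nth (linearization_step \<omega> f (linearization_approx \<omega> f (Suc \<bar>\<alpha>\<bar>\<^sub>m)) $ j) \<alpha>"
      by (rule linearization_step_cong[OF f V linearization_approx_in_V h, of "Suc \<bar>\<alpha>\<bar>\<^sub>m"]) simp_all
    also have "\<dots> = mfps_nth (h $ j) \<alpha>"
      using h[of \<alpha> "Suc (Suc \<bar>\<alpha>\<bar>\<^sub>m)" j] by simp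
    finally show "mfps_nth (linearization_step \<omega> f h $ j) \<alpha> = mfps_nth (h $ j) \<alpha>" .
  qed
  with V have ex: "is_linearization (diag_mat \<omega>) f h"
    by (simp add: is_linearization_iff[OF assms])
  have "h' = h" if "is_linearization (diag_mat \<omega>) f h'" for h'
  proof (intro vfps_eq_iff[THEN iffD2] allI)
    fix j \<alpha>
    have "h' \<in> V_space 1" "linearization_step \<omega> f h' = h'"
      using that by (simp_all add: is_linearization_iff[OF assms])
    then show "mfps_nth (h' $ j) \<alpha> = mfps_nth (h $ j) \<alpha>"
      using linearization_step_fixpoint_agrees_approx[OF f, of h' _ \<alpha> "Suc \<bar>\<alpha>\<bar>\<^sub>m" j] h[of \<alpha> "Suc \<bar>\<alpha>\<bar>\<^sub>m" j]
      by simp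
  qed
  with ex show "\<exists>!h. is_linearization (diag_mat \<omega>) f h" by blast
qed


section \<open>Small divisors and near resonances\<close>

lemma finite_admissible: "finite {\<gamma> :: int ^ 'n. admissible \<gamma> \<and> \<bar>\<gamma>\<bar>\<^sub>m < int p}"
proof (rule finite_subset)
  let ?f = "\<lambda>\<beta> :: nat ^ 'n. \<chi> i. int (\<beta> $ i) - 1"
  show "{\<gamma>. admissible \<gamma> \<and> \<bar>\<gamma>\<bar>\<^sub>m < int p} \<subseteq> ?f ` {\<beta>. \<bar>\<beta>\<bar>\<^sub>m \<le> p + CARD('n)}"
  proof clarify
    fix \<gamma> :: "int ^ 'n"
    assume "admissible \<gamma>" and less: "\<bar>\<gamma>\<bar>\<^sub>m < int p"
    then obtain j where "\<gamma> $ j \<ge> -1" "\<And>i. i \<noteq> j \<Longrightarrow> \<gamma> $ i \<ge> 0"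
      by (auto simp: admissible_def)
    then have ge: "\<gamma> $ i \<ge> -1" for i
      by (cases "i = j") (auto intro: order_trans[of "-1" 0])
    have nonneg: "\<gamma> $ i + 1 \<ge> 0" for i
      using ge[of i] by linarith
    define \<beta> where "\<beta> = (\<chi> i. nat (\<gamma> $ i + 1))"
    have "int \<bar>\<beta>\<bar>\<^sub>m = (\<Sum>i\<in>UNIV. \<gamma> $ i + 1)"
      unfolding mdeg_def of_nat_sum \<beta>_def
      by (rule sum.cong) (simp_all add: nonneg)
    then have "int \<bar>\<beta>\<bar>\<^sub>m = \<bar>\<gamma>\<bar>\<^sub>m + int CARD('n)"
      by (simp add: mdeg_def sum.distrib)
    then have "\<bar>\<beta>\<bar>\<^sub>m \<le> p + CARD('n)"
      using less by linarith
    moreover have "\<gamma> = ?f \<beta>"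
      by (simp add: \<beta>_def vec_eq_iff nonneg)
    ultimately show "\<gamma> \<in> ?f ` {\<beta>. \<bar>\<beta>\<bar>\<^sub>m \<le> p + CARD('n)}"
      by blast
  qed
  show "finite (?f ` {\<beta>. \<bar>\<beta>\<bar>\<^sub>m \<le> p + CARD('n)})"
    by (intro finite_imageI finite_mdeg_le)
qed

lemma finite_Omega_hat_set:
  "finite {cmod (idot \<alpha> \<omega>) | \<alpha>. admissible \<alpha> \<and> idot \<alpha> \<omega> \<noteq> 0 \<and> 0 < \<bar>\<alpha>\<bar>\<^sub>m \<and> \<bar>\<alpha>\<bar>\<^sub>m < int p}"
  by (rule finite_subset[OF _ finite_imageI[OF finite_admissible[of p], of "\<lambda>\<alpha>. cmod (idot \<alpha> \<omega>)"]]) auto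

lemma Omega_hat_le_small_divisor:
  assumes "\<not> resonant \<omega>" "2 \<le> \<bar>\<nu>\<bar>\<^sub>m" "\<bar>\<nu>\<bar>\<^sub>m \<le> p"
  shows "Omega_hat \<omega> p \<le> cmod (small_divisor \<omega> j \<nu>)"
proof -
  define \<gamma> where "\<gamma> = (\<chi> i. int (\<nu> $ i)) - axis j 1"
  have \<gamma>: "idot \<gamma> \<omega> = small_divisor \<omega> j \<nu>"
  proof -
    have "(\<Sum>i\<in>UNIV. of_int (axis j (1::int) $ i) * \<omega> $ i) = (\<Sum>i\<in>UNIV. if i = j then \<omega> $ i else 0)"
      by (rule sum.cong) (auto simp: axis_def)
    then show ?thesis
      by (simp add: \<gamma>_def small_divisor_def idot_def left_diff_distrib sum_subtractf)
  qed
  have "\<bar>\<gamma>\<bar>\<^sub>m = int \<bar>\<nu>\<bar>\<^sub>m - \<bar>axis j 1 :: int ^ 'a\<bar>\<^sub>m"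
    by (simp add: mdeg_def \<gamma>_def sum_subtractf)
  then have "\<bar>\<gamma>\<bar>\<^sub>m = int \<bar>\<nu>\<bar>\<^sub>m - 1"
    by (simp only: mdeg_axis)
  moreover have "admissible \<gamma>"
    by (auto simp: admissible_def \<gamma>_def axis_def intro!: exI[of _ j])
  ultimately show ?thesis
    unfolding Omega_hat_def using assms small_divisor_nonzero[OF assms(1,2)] \<gamma>
    by (intro Min_le finite_Omega_hat_set CollectI exI[of _ \<gamma>]) simp
qed

text \<open>
  Non-resonance for \<open>\<alpha> = 2 e\<^sub>j\<close> says \<open>2 \<omega>\<^sub>j - \<omega>\<^sub>j \<noteq> 0\<close>, so \<open>\<alpha> = e\<^sub>j\<close> is a witness.
\<close>

lemma Omega_hat_set_nonempty:
  fixes \<omega> :: "complex ^ 'n"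
  assumes "\<not> resonant \<omega>" "p \<ge> 2"
  shows "{cmod (idot \<alpha> \<omega>) | \<alpha>. admissible \<alpha> \<and> idot \<alpha> \<omega> \<noteq> 0 \<and> 0 < \<bar>\<alpha>\<bar>\<^sub>m \<and> \<bar>\<alpha>\<bar>\<^sub>m < int p} \<noteq> {}"
proof -
  fix j :: 'n
  have sum: "(\<Sum>i\<in>UNIV. of_int (axis j (c::int) $ i) * \<omega> $ i) = of_int c * \<omega> $ j" for c
  proof -
    have "(\<Sum>i\<in>UNIV. of_int (axis j c $ i) * \<omega> $ i) = (\<Sum>i\<in>UNIV. if i = j then of_int c * \<omega> $ i else 0)"
      by (rule sum.cong) (auto simp: axis_def)
    then show ?thesis by simp
  qed
  have adm: "admissible (axis j (c :: int))" if "c \<ge> 0" for c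
    unfolding admissible_def by (rule exI[of _ j]) (use that in \<open>auto simp: axis_def\<close>)
  have "idot (axis j 2) \<omega> - \<omega> $ j \<noteq> 0"
    using assms(1) adm[of 2] mdeg_axis[of j "2 :: int"] unfolding resonant_def by force
  then have "idot (axis j 1) \<omega> \<noteq> 0"
    by (simp add: idot_def sum del: One_nat_def)
  then show ?thesis
    using adm[of 1] mdeg_axis[of j "1 :: int"] assms(2) by (auto intro!: exI[of _ "axis j 1"])
qed

lemma Omega_hat_pos:
  assumes "\<not> resonant \<omega>" "p \<ge> 2"
  shows "Omega_hat \<omega> p > 0"
  unfolding Omega_hat_def
  by (subst Min_gr_iff) (use Omega_hat_set_nonempty[OF assms] in \<open>auto simp: finite_Omega_hat_set\<close>)

lemma Omega_hat_antimono:
  assumes "\<not> resonant \<omega>" "2 \<le> p" "p \<le> q"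
  shows "Omega_hat \<omega> q \<le> Omega_hat \<omega> p"
  unfolding Omega_hat_def
  by (rule Min_antimono[OF _ Omega_hat_set_nonempty[OF assms(1,2)] finite_Omega_hat_set])
     (use assms(3) in fastforce)

text \<open>
  The difference of two divisors is again a divisor, of degree one more than the difference of the
  degrees.  Bruno's counting argument rests on this identity.
\<close>

lemma small_divisor_diff:
  "small_divisor \<omega> j (\<alpha> + \<rho>) - small_divisor \<omega> k \<alpha> = small_divisor \<omega> j (\<rho> + axis k 1)"
proof -
  have "(\<Sum>i\<in>UNIV. of_nat (axis k (1::nat) $ i) * \<omega> $ i) = (\<Sum>i\<in>UNIV. if i = k then \<omega> $ i else 0)"
    by (rule sum.cong) (auto simp: axis_def)
  then show ?thesis
    by (simp add: small_divisor_def idot_def distrib_right sum.distrib)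
qed

text \<open>
  The threshold is half of \<open>\<Omega>(p)\<close> so that the difference of two divisors below it is smaller
  than \<open>\<Omega>(p)\<close>.
\<close>

definition near_resonant :: "complex ^ 'n \<Rightarrow> nat \<Rightarrow> nat ^ 'n \<Rightarrow> bool"
  where "near_resonant \<omega> p \<nu> \<longleftrightarrow> (\<exists>j. cmod (small_divisor \<omega> j \<nu>) < Omega_hat \<omega> p / 2)"

lemma near_resonant_mdeg_gt:
  assumes "\<not> resonant \<omega>" "near_resonant \<omega> p \<nu>" "\<bar>\<nu>\<bar>\<^sub>m \<ge> 2"
  shows "\<bar>\<nu>\<bar>\<^sub>m > p"
proof (rule ccontr)
  obtain j where j: "cmod (small_divisor \<omega> j \<nu>) < Omega_hat \<omega> p / 2"
    using assms(2) by (auto simp: near_resonant_def)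
  assume "\<not> \<bar>\<nu>\<bar>\<^sub>m > p"
  then have "Omega_hat \<omega> p \<le> cmod (small_divisor \<omega> j \<nu>)"
    using assms by (intro Omega_hat_le_small_divisor) auto
  with j norm_ge_zero[of "small_divisor \<omega> j \<nu>"] show False by linarith
qed

text \<open>
  Were \<open>0 < |\<rho>| < p\<close>, the difference of the two divisors would be a nonzero divisor of degree
  \<open>|\<rho>| + 1 \<le> p\<close> and of modulus less than \<open>\<Omega>(p)\<close>.
\<close>

lemma near_resonant_separated:
  assumes "\<not> resonant \<omega>" "near_resonant \<omega> p \<alpha>" "near_resonant \<omega> p (\<alpha> + \<rho>)" "\<rho> \<noteq> 0"
  shows "\<bar>\<rho>\<bar>\<^sub>m \<ge> p"
proof (rule ccontr)
  obtain j k where jk: "cmod (small_divisor \<omega> k \<alpha>) < Omega_hat \<omega> p / 2"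
      "cmod (small_divisor \<omega> j (\<alpha> + \<rho>)) < Omega_hat \<omega> p / 2"
    using assms(2,3) by (auto simp: near_resonant_def)
  have "\<bar>\<rho>\<bar>\<^sub>m \<noteq> 0" using assms(4) by (simp add: mdeg_eq_0_iff)
  moreover assume "\<not> \<bar>\<rho>\<bar>\<^sub>m \<ge> p"
  ultimately have "Omega_hat \<omega> p \<le> cmod (small_divisor \<omega> j (\<rho> + axis k 1))"
    using assms(1) by (intro Omega_hat_le_small_divisor) (auto simp: mdeg_add mdeg_axis)
  also have "\<dots> \<le> cmod (small_divisor \<omega> j (\<alpha> + \<rho>)) + cmod (small_divisor \<omega> k \<alpha>)"
    by (metis norm_triangle_ineq4 small_divisor_diff)
  finally show False using jk by linarith
qed


section \<open>Forests of multi-indices and their near-resonant nodes\<close>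

text \<open>
  Unfolding the recursion for the linearization expresses a coefficient of degree \<open>\<alpha>\<close> through rooted
  trees whose leaves are linear monomials with exponents adding up to \<open>\<alpha>\<close>; every internal node has
  at least two children and contributes the divisor of the sum of the exponents above it.
  Here \<open>forest s \<alpha> \<nu>s\<close> stands for an ordered sequence of \<open>s\<close> such trees with total exponent \<open>\<alpha>\<close>,
  and \<open>\<nu>s\<close> lists the exponents of the internal nodes.  Only this list matters below, so the trees
  themselves are not recorded.  Adding one tree at a time matches the computation of
  \<open>g\<^sup>\<beta>\<close> as an iterated product.
\<close>

inductive forest :: "nat \<Rightarrow> nat ^ 'n \<Rightarrow> (nat ^ 'n) list \<Rightarrow> bool" where
  leaf: "forest 1 (axis i 1) []"
| join: "forest s \<alpha> \<nu>s \<Longrightarrow> forest 1 \<beta> \<mu>s \<Longrightarrow> forest (s + 1) (\<alpha> + \<beta>) (\<nu>s @ \<mu>s)"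
| graft: "forest s \<alpha> \<nu>s \<Longrightarrow> s \<ge> 2 \<Longrightarrow> forest 1 \<alpha> (\<alpha> # \<nu>s)"

lemma forest_size:
  assumes "forest s \<alpha> \<nu>s"
  shows "s \<ge> 1" "length \<nu>s + s \<le> \<bar>\<alpha>\<bar>\<^sub>m" "\<forall>\<nu>\<in>set \<nu>s. 2 \<le> \<bar>\<nu>\<bar>\<^sub>m \<and> \<bar>\<nu>\<bar>\<^sub>m \<le> \<bar>\<alpha>\<bar>\<^sub>m"
  using assms by (induction rule: forest.induct) (auto simp: mdeg_add mdeg_axis[of _ "Suc 0"])

text \<open>
  Bruno's counting lemma: a forest of degree \<open>|\<alpha>| > p\<close> has at most \<open>2 |\<alpha>| / p - 1\<close> near-resonant
  nodes.  The bound is superadditive in the degree, so only a near-resonant root that is grafted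
  on a forest could violate it.  The last conjunct serves that step.  It saves one more node
  whenever the forest lies below some near-resonant \<open>\<alpha> + \<rho>\<close>, strictly so if it is a single tree:
  if at least two of its trees have degree above \<open>p\<close>, both subtract 1; if none does, there is nothing
  to count, and \<open>|\<alpha> + \<rho>| > p\<close>; if exactly one does, the claim descends into that tree until it meets
  one of the other two cases or a near-resonant root, whose degree is at most \<open>|\<alpha> + \<rho>| - p\<close> by
  separation.
  Multiplication by \<open>p\<close> keeps everything in the natural numbers.
\<close>

lemma forest_near_resonant_count:
  assumes "forest s \<alpha> \<nu>s" and nonres: "\<not> resonant \<omega>" and "p \<ge> 1"
  defines "N \<equiv> \<lambda>\<nu>s. length (filter (near_resonant \<omega> p) \<nu>s)"
  shows "(\<bar>\<alpha>\<bar>\<^sub>m \<le> p \<longrightarrow> N \<nu>s = 0) \<and>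
    (\<bar>\<alpha>\<bar>\<^sub>m > p \<longrightarrow> N \<nu>s * p + p \<le> 2 * \<bar>\<alpha>\<bar>\<^sub>m) \<and>
    (\<forall>\<rho>. near_resonant \<omega> p (\<alpha> + \<rho>) \<longrightarrow> s \<ge> 2 \<or> \<rho> \<noteq> 0 \<longrightarrow> N \<nu>s * p + 2 * p \<le> 2 * \<bar>\<alpha> + \<rho>\<bar>\<^sub>m)"
  using assms(1)
proof (induction rule: forest.induct)
  case (leaf i)
  have "2 * p \<le> 2 * \<bar>axis i 1 + \<rho>\<bar>\<^sub>m"
    if "near_resonant \<omega> p (axis i 1 + \<rho>)" "\<rho> \<noteq> 0" for \<rho>
  proof -
    have "\<bar>\<rho>\<bar>\<^sub>m \<noteq> 0" using that(2) by (simp add: mdeg_eq_0_iff)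
    then have "\<bar>axis i 1 + \<rho>\<bar>\<^sub>m \<ge> 2" by (simp add: mdeg_add mdeg_axis del: One_nat_def)
    from near_resonant_mdeg_gt[OF nonres that(1) this] show ?thesis by linarith
  qed
  then show ?case
    using \<open>p \<ge> 1\<close> by (simp add: N_def mdeg_axis del: One_nat_def)
next
  case (join s \<alpha> \<nu>s \<beta> \<mu>s)
  let ?a = "\<bar>\<alpha>\<bar>\<^sub>m" and ?b = "\<bar>\<beta>\<bar>\<^sub>m"
  have pos: "?a \<ge> 1" "?b \<ge> 1"
    using forest_size(1,2)[OF join.hyps(1)] forest_size(1,2)[OF join.hyps(2)] by linarith+
  have N: "N (\<nu>s @ \<mu>s) * p = N \<nu>s * p + N \<mu>s * p"
    by (simp add: N_def algebra_simps)
  have "N (\<nu>s @ \<mu>s) * p + 2 * p \<le> 2 * \<bar>\<alpha> + \<beta> + \<rho>\<bar>\<^sub>m"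
    if near: "near_resonant \<omega> p (\<alpha> + \<beta> + \<rho>)" for \<rho>
  proof -
    have "\<bar>\<alpha> + \<beta> + \<rho>\<bar>\<^sub>m > p"
      using near_resonant_mdeg_gt[OF nonres near] pos by (simp add: mdeg_add)
    moreover have "N \<nu>s * p + 2 * p \<le> 2 * \<bar>\<alpha> + \<beta> + \<rho>\<bar>\<^sub>m"
    proof -
      have "\<beta> + \<rho> \<noteq> 0" using pos by (auto simp: mdeg_add simp flip: mdeg_eq_0_iff)
      with join.IH(1) near show ?thesis by (simp add: add.assoc)
    qed
    moreover have "N \<mu>s * p + 2 * p \<le> 2 * \<bar>\<alpha> + \<beta> + \<rho>\<bar>\<^sub>m"
    proof -
      have "\<alpha> + \<rho> \<noteq> 0" using pos by (auto simp: mdeg_add simp flip: mdeg_eq_0_iff)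
      moreover have "\<beta> + (\<alpha> + \<rho>) = \<alpha> + \<beta> + \<rho>" by (simp add: ac_simps)
      ultimately show ?thesis using join.IH(2) near by metis
    qed
    ultimately show ?thesis
      using join.IH unfolding N mdeg_add by (cases "?a \<le> p"; cases "?b \<le> p") auto
  qed
  then show ?case
    using join.IH unfolding N mdeg_add by (cases "?a \<le> p"; cases "?b \<le> p") (auto simp: N_def)
next
  case (graft s \<alpha> \<nu>s)
  have deg: "\<bar>\<alpha>\<bar>\<^sub>m \<ge> 2"
    using forest_size(2)[OF graft.hyps(1)] graft.hyps(2) by linarith
  show ?case
  proof (cases "near_resonant \<omega> p \<alpha>")
    case True
    have "\<bar>\<alpha>\<bar>\<^sub>m > p" by (rule near_resonant_mdeg_gt[OF nonres True deg])
    moreover have "N \<nu>s * p + 2 * p \<le> 2 * \<bar>\<alpha>\<bar>\<^sub>m"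
      using graft.IH graft.hyps(2) True by (metis add.right_neutral)
    moreover have "\<bar>\<alpha> + \<rho>\<bar>\<^sub>m \<ge> \<bar>\<alpha>\<bar>\<^sub>m + p" if "near_resonant \<omega> p (\<alpha> + \<rho>)" "\<rho> \<noteq> 0" for \<rho>
      using near_resonant_separated[OF nonres True that] by (simp add: mdeg_add)
    moreover have "N (\<alpha> # \<nu>s) = N \<nu>s + 1"
      using True by (simp add: N_def)
    ultimately show ?thesis by fastforce
  next
    case False
    then have "N (\<alpha> # \<nu>s) = N \<nu>s"
      by (simp add: N_def)
    with graft.IH graft.hyps(2) show ?thesis by simp
  qed
qed


section \<open>The product of the small divisors of a forest\<close>

definition divisor_size :: "complex ^ 'n \<Rightarrow> nat ^ 'n \<Rightarrow> real"
  where "divisor_size \<omega> \<nu> = Min (range (\<lambda>j. cmod (small_divisor \<omega> j \<nu>)))"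

lemma divisor_size_le: "divisor_size \<omega> \<nu> \<le> cmod (small_divisor \<omega> j \<nu>)"
  unfolding divisor_size_def by (rule Min_le) auto

lemma divisor_size_attained: "\<exists>j. divisor_size \<omega> \<nu> = cmod (small_divisor \<omega> j \<nu>)"
proof -
  have "divisor_size \<omega> \<nu> \<in> range (\<lambda>j. cmod (small_divisor \<omega> j \<nu>))"
    unfolding divisor_size_def by (rule Min_in) auto
  then show ?thesis by auto
qed

lemma divisor_size_nonneg: "divisor_size \<omega> \<nu> \<ge> 0"
  using divisor_size_attained[of \<omega> \<nu>] by auto

definition divisor_product :: "complex ^ 'n \<Rightarrow> (nat ^ 'n) list \<Rightarrow> real"
  where "divisor_product \<omega> \<nu>s = (\<Prod>\<nu>\<leftarrow>\<nu>s. 1 / divisor_size \<omega> \<nu>)"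

text \<open>
  The worst product of inverse divisors over all forests of a given degree.  The extra element 0
  settles the case without forests: the weight is then 0, and \<open>forest_weight_join\<close> holds
  unconditionally.
\<close>

definition forest_weight :: "complex ^ 'n \<Rightarrow> nat \<Rightarrow> nat ^ 'n \<Rightarrow> real"
  where "forest_weight \<omega> s \<alpha> = Sup (insert 0 {divisor_product \<omega> \<nu>s | \<nu>s. forest s \<alpha> \<nu>s})"

lemma divisor_product_nonneg: "divisor_product \<omega> \<nu>s \<ge> 0"
  unfolding divisor_product_def by (induction \<nu>s) (simp_all add: divisor_size_nonneg)

lemma bdd_above_divisor_products: "bdd_above (insert 0 {divisor_product \<omega> \<nu>s | \<nu>s. forest s \<alpha> \<nu>s})"
proof (rule bdd_above_finite)
  have "{\<nu>s. forest s \<alpha> \<nu>s} \<subseteq> {\<nu>s. set \<nu>s \<subseteq> {\<nu>. \<bar>\<nu>\<bar>\<^sub>m \<le> \<bar>\<alpha>\<bar>\<^sub>m} \<and> length \<nu>s \<le> \<bar>\<alpha>\<bar>\<^sub>m}"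
    using forest_size(2,3)[of s \<alpha>] by fastforce
  then have "finite {\<nu>s. forest s \<alpha> \<nu>s}"
    by (rule finite_subset) (intro finite_lists_length_le finite_mdeg_le)
  then show "finite (insert 0 {divisor_product \<omega> \<nu>s | \<nu>s. forest s \<alpha> \<nu>s})"
    by (simp add: setcompr_eq_image)
qed

lemma forest_weight_ge: "forest s \<alpha> \<nu>s \<Longrightarrow> divisor_product \<omega> \<nu>s \<le> forest_weight \<omega> s \<alpha>"
  unfolding forest_weight_def by (rule cSup_upper[OF _ bdd_above_divisor_products]) auto

lemma forest_weight_nonneg: "forest_weight \<omega> s \<alpha> \<ge> 0"
  unfolding forest_weight_def by (rule cSup_upper[OF _ bdd_above_divisor_products]) auto

lemma forest_weight_le:
  assumes "\<And>\<nu>s. forest s \<alpha> \<nu>s \<Longrightarrow> divisor_product \<omega> \<nu>s \<le> b" "b \<ge> 0"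
  shows "forest_weight \<omega> s \<alpha> \<le> b"
  unfolding forest_weight_def by (rule cSup_least) (use assms in auto)

lemma forest_weight_axis: "forest_weight \<omega> 1 (axis i 1) \<ge> 1"
  using forest_weight_ge[OF forest.leaf] by (simp add: divisor_product_def)

lemma forest_weight_join:
  "forest_weight \<omega> s \<alpha> * forest_weight \<omega> 1 \<beta> \<le> forest_weight \<omega> (s + 1) (\<alpha> + \<beta>)"
proof -
  define W where "W = forest_weight \<omega> (s + 1) (\<alpha> + \<beta>)"
  have W: "W \<ge> 0" by (simp add: W_def forest_weight_nonneg)
  have prod: "divisor_product \<omega> \<nu>s * divisor_product \<omega> \<mu>s \<le> W"
    if "forest s \<alpha> \<nu>s" "forest 1 \<beta> \<mu>s" for \<nu>s \<mu>s
    using forest_weight_ge[OF forest.join[OF that], of \<omega>] by (simp add: W_def divisor_product_def)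
  have step: "forest_weight \<omega> s \<alpha> * divisor_product \<omega> \<mu>s \<le> W" if \<mu>: "forest 1 \<beta> \<mu>s" for \<mu>s
  proof (cases "divisor_product \<omega> \<mu>s = 0")
    case False
    then have pos: "divisor_product \<omega> \<mu>s > 0"
      using divisor_product_nonneg[of \<omega> \<mu>s] by linarith
    have "forest_weight \<omega> s \<alpha> \<le> W / divisor_product \<omega> \<mu>s"
      by (rule forest_weight_le) (use prod[OF _ \<mu>] pos W in \<open>auto simp: field_simps\<close>)
    with pos show ?thesis by (simp add: field_simps)
  qed (simp add: W)
  have "forest_weight \<omega> s \<alpha> * forest_weight \<omega> 1 \<beta> \<le> W"
  proof (cases "forest_weight \<omega> s \<alpha> = 0")
    case False
    then have pos: "forest_weight \<omega> s \<alpha> > 0"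
      using forest_weight_nonneg[of \<omega> s \<alpha>] by linarith
    have "forest_weight \<omega> 1 \<beta> \<le> W / forest_weight \<omega> s \<alpha>"
      by (rule forest_weight_le) (use step pos W in \<open>auto simp: field_simps\<close>)
    with pos show ?thesis by (simp add: field_simps)
  qed (simp add: W)
  then show ?thesis by (simp add: W_def)
qed

text \<open>
  This is the inequality that lets a division by the divisor at \<open>\<alpha>\<close> be absorbed in the weight.
\<close>

lemma forest_weight_graft:
  assumes "s \<ge> 2" "divisor_size \<omega> \<alpha> > 0"
  shows "forest_weight \<omega> s \<alpha> \<le> divisor_size \<omega> \<alpha> * forest_weight \<omega> 1 \<alpha>"
proof (rule forest_weight_le)
  fix \<nu>s assume "forest s \<alpha> \<nu>s"
  from forest_weight_ge[OF forest.graft[OF this assms(1)], of \<omega>]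
  show "divisor_product \<omega> \<nu>s \<le> divisor_size \<omega> \<alpha> * forest_weight \<omega> 1 \<alpha>"
    using assms(2) by (simp add: divisor_product_def field_simps)
qed (simp add: divisor_size_nonneg forest_weight_nonneg)

text \<open>
  Positive parts are taken because the number of nodes at a given threshold is only bounded from
  above, which gives no estimate for a negative term.
\<close>

definition Bruno_sum :: "complex ^ 'n \<Rightarrow> (nat \<Rightarrow> nat) \<Rightarrow> nat \<Rightarrow> real"
  where "Bruno_sum \<omega> p k = (\<Sum>m\<le>k. max 0 (Bruno_term \<omega> p m))"

lemma kappa_bounds:
  assumes "index_seq p" "p 0 \<le> \<bar>\<alpha>\<bar>\<^sub>m"
  shows "p (kappa p \<alpha>) \<le> \<bar>\<alpha>\<bar>\<^sub>m \<and> \<bar>\<alpha>\<bar>\<^sub>m < p (kappa p \<alpha> + 1)"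
  unfolding kappa_def
proof (rule theI')
  have mono: "strict_mono p" using assms(1) by (simp add: index_seq_def)
  define k where "k = (GREATEST k. p k \<le> \<bar>\<alpha>\<bar>\<^sub>m)"
  have bound: "\<And>k. p k \<le> \<bar>\<alpha>\<bar>\<^sub>m \<Longrightarrow> k \<le> \<bar>\<alpha>\<bar>\<^sub>m"
    using strict_mono_imp_increasing[OF mono] le_trans by blast
  have k: "p k \<le> \<bar>\<alpha>\<bar>\<^sub>m"
    unfolding k_def by (rule GreatestI_nat[of "\<lambda>k. p k \<le> \<bar>\<alpha>\<bar>\<^sub>m" 0, OF assms(2) bound])
  have "l \<le> k" if "p l \<le> \<bar>\<alpha>\<bar>\<^sub>m" for l
    unfolding k_def by (rule Greatest_le_nat[of "\<lambda>k. p k \<le> \<bar>\<alpha>\<bar>\<^sub>m", OF that bound])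
  from this[of "k + 1"] have k1: "\<bar>\<alpha>\<bar>\<^sub>m < p (k + 1)"
    by linarith
  have "l = k" if "p l \<le> \<bar>\<alpha>\<bar>\<^sub>m" "\<bar>\<alpha>\<bar>\<^sub>m < p (l + 1)" for l
  proof -
    have "p l < p (k + 1)" "p k < p (l + 1)"
      using that k k1 by linarith+
    then have "l < k + 1" "k < l + 1"
      by (simp_all only: strict_mono_less[OF mono])
    then show ?thesis by simp
  qed
  with k k1 show "\<exists>!k. p k \<le> \<bar>\<alpha>\<bar>\<^sub>m \<and> \<bar>\<alpha>\<bar>\<^sub>m < p (k + 1)"
    by blast
qed

text \<open>
  Let \<open>m\<close> be the last index up to \<open>k\<close> for which \<open>\<nu>\<close> is near-resonant at \<open>p\<^sub>m\<close>.  Then the divisor at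
  \<open>\<nu>\<close> is at least \<open>\<Omega>(p\<^sub>m\<^sub>+\<^sub>1) / 2\<close>: for \<open>m < k\<close> by the choice of \<open>m\<close>, and for \<open>m = k\<close> because
  \<open>|\<nu>| < p\<^sub>k\<^sub>+\<^sub>1\<close>.  Index 0 is counted for every node, so that \<open>m\<close> always exists.
\<close>

lemma ln_inverse_divisor_size_le:
  assumes nonres: "\<not> resonant \<omega>" and p: "index_seq p"
    and \<nu>: "2 \<le> \<bar>\<nu>\<bar>\<^sub>m" "\<bar>\<nu>\<bar>\<^sub>m < p (k + 1)"
  defines "L \<equiv> \<lambda>m. max 0 (ln (inverse (Omega_hat \<omega> (p (m + 1)))))"
  shows "ln (1 / divisor_size \<omega> \<nu>)
    \<le> ln 2 + L 0 + (\<Sum>m\<in>{1..k}. if near_resonant \<omega> (p m) \<nu> then L m else 0)"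
proof -
  define P where "P m \<longleftrightarrow> m \<le> k \<and> (m = 0 \<or> near_resonant \<omega> (p m) \<nu>)" for m
  define m where "m = (GREATEST m. P m)"
  have bound: "m \<le> k" if "P m" for m using that by (simp add: P_def)
  have "P 0" by (simp add: P_def)
  then have Pm: "P m" unfolding m_def by (rule GreatestI_nat) (rule bound)
  have max: "l \<le> m" if "P l" for l
    unfolding m_def using that bound by (rule Greatest_le_nat)
  define \<Omega> where "\<Omega> = Omega_hat \<omega> (p (m + 1))"
  obtain j where j: "divisor_size \<omega> \<nu> = cmod (small_divisor \<omega> j \<nu>)"
    using divisor_size_attained by blast
  have "p (m + 1) > p 0" "p 0 > 0"
    using p by (auto simp: index_seq_def strict_mono_def)
  then have pos: "\<Omega> > 0"
    unfolding \<Omega>_def by (intro Omega_hat_pos[OF nonres]) auto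
  have ge: "divisor_size \<omega> \<nu> \<ge> \<Omega> / 2"
  proof (cases "m < k")
    case True
    then have "\<not> near_resonant \<omega> (p (m + 1)) \<nu>"
      using max[of "m + 1"] by (auto simp: P_def)
    then show ?thesis by (auto simp: near_resonant_def \<Omega>_def j not_less)
  next
    case False
    with Pm have "m = k" by (simp add: P_def)
    then have "\<Omega> \<le> divisor_size \<omega> \<nu>"
      using \<nu> by (auto simp: \<Omega>_def j intro!: Omega_hat_le_small_divisor[OF nonres])
    then show ?thesis using pos by simp
  qed
  have "ln (1 / divisor_size \<omega> \<nu>) \<le> ln (2 / \<Omega>)"
    using pos ge by (subst ln_le_cancel_iff) (auto simp: field_simps)
  also have "\<dots> = ln 2 + ln (inverse \<Omega>)"
    using pos by (simp add: divide_inverse ln_mult)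
  also have "\<dots> \<le> ln 2 + L m"
    by (simp add: L_def \<Omega>_def)
  also have "L m \<le> L 0 + (\<Sum>m\<in>{1..k}. if near_resonant \<omega> (p m) \<nu> then L m else 0)"
  proof (cases "m = 0")
    case True
    then show ?thesis by (auto simp: L_def intro!: sum_nonneg)
  next
    case False
    then have "(if near_resonant \<omega> (p m) \<nu> then L m else 0)
        \<le> (\<Sum>m\<in>{1..k}. if near_resonant \<omega> (p m) \<nu> then L m else 0)"
      using Pm by (intro member_le_sum) (auto simp: P_def L_def)
    moreover have "L 0 \<ge> 0" by (simp add: L_def)
    ultimately show ?thesis using False Pm by (auto simp: P_def)
  qed
  finally show ?thesis by simp
qed

lemma sum_list_if_eq_count:
  "(\<Sum>x\<leftarrow>xs. if P x then c else 0) = real (length (filter P xs)) * c"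
  by (induction xs) (simp_all add: algebra_simps)

lemma ln_divisor_product:
  assumes "\<And>\<nu>. \<nu> \<in> set \<nu>s \<Longrightarrow> divisor_size \<omega> \<nu> > 0"
  shows "divisor_product \<omega> \<nu>s = exp (\<Sum>\<nu>\<leftarrow>\<nu>s. ln (1 / divisor_size \<omega> \<nu>))"
  using assms by (induction \<nu>s) (simp_all add: divisor_product_def exp_add)

text \<open>
  Summed over the nodes, the term of index \<open>m \<ge> 1\<close> occurs at most \<open>2 |\<alpha>| / p\<^sub>m\<close> times by the
  counting lemma.  The term of index 0 and the factors 2 occur once per node, hence at most \<open>|\<alpha>|\<close>
  times, and go into the constant \<open>c\<close>.
\<close>

lemma forest_weight_Bruno_bound:
  assumes nonres: "\<not> resonant \<omega>" and p: "index_seq p"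
  defines "c \<equiv> ln 2 + max 0 (ln (inverse (Omega_hat \<omega> (p 1))))"
  assumes \<alpha>: "p 0 \<le> \<bar>\<alpha>\<bar>\<^sub>m"
  shows "forest_weight \<omega> s \<alpha> \<le> exp (real \<bar>\<alpha>\<bar>\<^sub>m * (c + 2 * Bruno_sum \<omega> p (kappa p \<alpha>)))"
proof (rule forest_weight_le)
  define k where "k = kappa p \<alpha>"
  define L where "L m = max 0 (ln (inverse (Omega_hat \<omega> (p (m + 1)))))" for m
  define d where "d = real \<bar>\<alpha>\<bar>\<^sub>m"
  have L0: "L m \<ge> 0" for m by (simp add: L_def)
  have p_pos: "p m \<ge> 1" for m
    using p strict_mono_less_eq[of p 0 m] by (auto simp: index_seq_def)
  have summand: "max 0 (Bruno_term \<omega> p m) = L m / real (p m)" for m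
    using p_pos[of m] by (auto simp: Bruno_term_def L_def max_def divide_le_0_iff zero_le_divide_iff)
  fix \<nu>s assume F: "forest s \<alpha> \<nu>s"
  note size = forest_size[OF F]
  have len: "real (length \<nu>s) \<le> d"
    using size(2) by (simp add: d_def)
  have count: "real (length (filter (near_resonant \<omega> (p m)) \<nu>s)) * L m \<le> 2 * d * (L m / real (p m))" for m
  proof -
    let ?N = "length (filter (near_resonant \<omega> (p m)) \<nu>s)"
    have "?N * p m \<le> 2 * \<bar>\<alpha>\<bar>\<^sub>m"
      using forest_near_resonant_count[OF F nonres p_pos[of m]] by (cases "\<bar>\<alpha>\<bar>\<^sub>m \<le> p m") auto
    then have "real ?N * real (p m) \<le> 2 * d"
      unfolding d_def by (simp flip: of_nat_mult)
    then have "real ?N \<le> 2 * d / real (p m)"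
      using p_pos[of m] by (simp add: field_simps)
    from mult_right_mono[OF this L0[of m]] show ?thesis by simp
  qed
  have size_pos: "divisor_size \<omega> \<nu> > 0" if "\<nu> \<in> set \<nu>s" for \<nu>
    using divisor_size_attained[of \<omega> \<nu>] size(3) that small_divisor_nonzero[OF nonres] by fastforce
  have "(\<Sum>\<nu>\<leftarrow>\<nu>s. ln (1 / divisor_size \<omega> \<nu>))
      \<le> (\<Sum>\<nu>\<leftarrow>\<nu>s. c + (\<Sum>m\<in>{1..k}. if near_resonant \<omega> (p m) \<nu> then L m else 0))"
  proof (rule sum_list_mono)
    fix \<nu> assume "\<nu> \<in> set \<nu>s"
    then have "2 \<le> \<bar>\<nu>\<bar>\<^sub>m" "\<bar>\<nu>\<bar>\<^sub>m < p (k + 1)"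
      using size(3) kappa_bounds[OF p \<alpha>] by (auto simp: k_def)
    from ln_inverse_divisor_size_le[OF nonres p this]
    show "ln (1 / divisor_size \<omega> \<nu>) \<le> c + (\<Sum>m\<in>{1..k}. if near_resonant \<omega> (p m) \<nu> then L m else 0)"
      unfolding c_def L_def by simp
  qed
  also have "\<dots> = real (length \<nu>s) * c
      + (\<Sum>m\<in>{1..k}. real (length (filter (near_resonant \<omega> (p m)) \<nu>s)) * L m)"
    unfolding sum_list_addf sum_list_if_eq_count[symmetric]
    by (induction \<nu>s) (simp_all add: sum.distrib algebra_simps)
  also have "\<dots> \<le> d * c + (\<Sum>m\<in>{1..k}. 2 * d * max 0 (Bruno_term \<omega> p m))"
    using len count by (intro add_mono mult_right_mono sum_mono) (auto simp: summand c_def)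
  also have "\<dots> \<le> d * c + (\<Sum>m\<le>k. 2 * d * max 0 (Bruno_term \<omega> p m))"
    by (intro add_left_mono sum_mono2) (auto simp: d_def)
  also have "\<dots> = d * (c + 2 * Bruno_sum \<omega> p k)"
    by (simp add: Bruno_sum_def algebra_simps flip: sum_distrib_left)
  finally show "divisor_product \<omega> \<nu>s \<le> exp (real \<bar>\<alpha>\<bar>\<^sub>m * (c + 2 * Bruno_sum \<omega> p (kappa p \<alpha>)))"
    using ln_divisor_product[of \<nu>s \<omega>, OF size_pos] by (simp add: d_def k_def)
qed simp


section \<open>The majorant estimate\<close>

text \<open>
  Multiplying by one more component of \<open>g\<close> costs a factor \<open>c 16\<^sup>n\<close> from the convolution of the decay
  factors, merges two weights \<open>M\<^sub>k M\<^sub>l \<le> M\<^sub>k\<^sub>+\<^sub>l\<^sub>-\<^sub>1\<close>, and joins one more tree to the forest.  The index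
  of \<open>M\<close> drops by one at each product, which leaves room for the factor \<open>M\<^bsub>|\<beta>|\<^esub>\<close> from the
  coefficient of the outer series.
\<close>

lemma mpow_nth_bound:
  fixes g :: "'n::finite vfps" and M :: "nat \<Rightarrow> real"
  assumes M_pos: "\<And>k. k \<ge> 1 \<Longrightarrow> M k > 0"
    and M_mult: "\<And>k l. k \<ge> 1 \<Longrightarrow> l \<ge> 1 \<Longrightarrow> M k * M l \<le> M (k + l - 1)"
    and c: "c > 0" and K: "K > 0"
    and g0: "\<And>i. mfps_nth (g $ i) 0 = 0"
    and g: "\<And>i \<alpha>. \<bar>\<alpha>\<bar>\<^sub>m \<ge> 1 \<Longrightarrow>
      cmod (mfps_nth (g $ i) \<alpha>) \<le> c * K ^ \<bar>\<alpha>\<bar>\<^sub>m * decay \<alpha> * M \<bar>\<alpha>\<bar>\<^sub>m * forest_weight \<omega> 1 \<alpha>"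
    and "\<beta> \<noteq> 0" "\<bar>\<beta>\<bar>\<^sub>m \<le> \<bar>\<alpha>\<bar>\<^sub>m"
  shows "cmod (mfps_nth (mpow g \<beta>) \<alpha>) \<le> c * (c * 16 ^ CARD('n)) ^ (\<bar>\<beta>\<bar>\<^sub>m - 1) * K ^ \<bar>\<alpha>\<bar>\<^sub>m * decay \<alpha> *
    M (\<bar>\<alpha>\<bar>\<^sub>m + 1 - \<bar>\<beta>\<bar>\<^sub>m) * forest_weight \<omega> \<bar>\<beta>\<bar>\<^sub>m \<alpha>"
  using assms(7,8)
proof (induction \<beta> arbitrary: \<alpha> rule: mindex_induct)
  case (axis i)
  then have "\<bar>\<alpha>\<bar>\<^sub>m \<ge> 1" by (simp add: mdeg_axis del: One_nat_def)
  from g[OF this, of i] show ?case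
    by (simp add: mdeg_axis mpow_axis del: One_nat_def)
next
  case (add \<beta> i)
  define s where "s = \<bar>\<beta>\<bar>\<^sub>m"
  define q where "q = c * 16 ^ CARD('n)"
  have s: "s \<ge> 1" using add.hyps by (simp add: s_def mdeg_eq_0_iff Suc_le_eq flip: neq0_conv)
  have a: "s + 1 \<le> \<bar>\<alpha>\<bar>\<^sub>m" using add.prems by (simp add: mdeg_add mdeg_axis s_def del: One_nat_def)
  have q: "q > 0" using c by (simp add: q_def)
  define W where "W = forest_weight \<omega> (s + 1) \<alpha>"
  define X where "X = c * q ^ (s - 1) * c * K ^ \<bar>\<alpha>\<bar>\<^sub>m * M (\<bar>\<alpha>\<bar>\<^sub>m - s) * W"
  have W: "W \<ge> 0" by (simp add: W_def forest_weight_nonneg)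
  have "M (\<bar>\<alpha>\<bar>\<^sub>m - s) > 0" using a by (intro M_pos) simp
  then have X: "X \<ge> 0"
    unfolding X_def using c K q W by simp
  have summand: "cmod (mfps_nth (mpow g \<beta>) \<gamma> * mfps_nth (g $ i) \<epsilon>) \<le> X * (decay \<gamma> * decay \<epsilon>)"
    if \<alpha>: "\<gamma> + \<epsilon> = \<alpha>" for \<gamma> \<epsilon>
  proof (cases "\<epsilon> = 0 \<or> \<bar>\<gamma>\<bar>\<^sub>m < s")
    case True
    then have "mfps_nth (mpow g \<beta>) \<gamma> * mfps_nth (g $ i) \<epsilon> = 0"
      using g0 by (auto simp: mpow_nth_eq_0 s_def)
    then have "cmod (mfps_nth (mpow g \<beta>) \<gamma> * mfps_nth (g $ i) \<epsilon>) = 0"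
      by (simp only: norm_zero)
    also have "0 \<le> X * (decay \<gamma> * decay \<epsilon>)"
      using X decay_pos[of \<gamma>] decay_pos[of \<epsilon>] by simp
    finally show ?thesis .
  next
    case False
    then have deg: "\<bar>\<epsilon>\<bar>\<^sub>m \<ge> 1" "s \<le> \<bar>\<gamma>\<bar>\<^sub>m"
      by (auto simp: mdeg_eq_0_iff Suc_le_eq simp flip: neq0_conv)
    have sum: "\<bar>\<alpha>\<bar>\<^sub>m = \<bar>\<gamma>\<bar>\<^sub>m + \<bar>\<epsilon>\<bar>\<^sub>m" by (simp add: mdeg_add flip: \<alpha>)
    have MM: "M (\<bar>\<gamma>\<bar>\<^sub>m + 1 - s) * M \<bar>\<epsilon>\<bar>\<^sub>m \<le> M (\<bar>\<alpha>\<bar>\<^sub>m - s)"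
      using M_mult[of "\<bar>\<gamma>\<bar>\<^sub>m + 1 - s" "\<bar>\<epsilon>\<bar>\<^sub>m"] deg by (simp add: sum)
    have WW: "forest_weight \<omega> s \<gamma> * forest_weight \<omega> 1 \<epsilon> \<le> W"
      unfolding W_def \<alpha>[symmetric] by (rule forest_weight_join)
    have M0: "M (\<bar>\<gamma>\<bar>\<^sub>m + 1 - s) > 0" "M \<bar>\<epsilon>\<bar>\<^sub>m > 0"
      using deg by (auto intro: M_pos)
    have "cmod (mfps_nth (mpow g \<beta>) \<gamma> * mfps_nth (g $ i) \<epsilon>)
        \<le> (c * q ^ (s - 1) * K ^ \<bar>\<gamma>\<bar>\<^sub>m * decay \<gamma> * M (\<bar>\<gamma>\<bar>\<^sub>m + 1 - s) * forest_weight \<omega> s \<gamma>) *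
          (c * K ^ \<bar>\<epsilon>\<bar>\<^sub>m * decay \<epsilon> * M \<bar>\<epsilon>\<bar>\<^sub>m * forest_weight \<omega> 1 \<epsilon>)"
      unfolding norm_mult
    proof (rule mult_mono)
      show "cmod (mfps_nth (mpow g \<beta>) \<gamma>)
          \<le> c * q ^ (s - 1) * K ^ \<bar>\<gamma>\<bar>\<^sub>m * decay \<gamma> * M (\<bar>\<gamma>\<bar>\<^sub>m + 1 - s) * forest_weight \<omega> s \<gamma>"
        using add.IH[of \<gamma>] deg by (simp add: s_def q_def)
      show "0 \<le> c * q ^ (s - 1) * K ^ \<bar>\<gamma>\<bar>\<^sub>m * decay \<gamma> * M (\<bar>\<gamma>\<bar>\<^sub>m + 1 - s) * forest_weight \<omega> s \<gamma>"
        using c q K M0 decay_pos[of \<gamma>] forest_weight_nonneg[of \<omega> s \<gamma>] by simp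
    qed (use g[OF deg(1)] in auto)
    also have "\<dots> = (c * q ^ (s - 1) * c * K ^ \<bar>\<alpha>\<bar>\<^sub>m * (decay \<gamma> * decay \<epsilon>)) *
        ((M (\<bar>\<gamma>\<bar>\<^sub>m + 1 - s) * M \<bar>\<epsilon>\<bar>\<^sub>m) * (forest_weight \<omega> s \<gamma> * forest_weight \<omega> 1 \<epsilon>))"
      by (simp add: sum power_add mult_ac)
    also have "\<dots> \<le> (c * q ^ (s - 1) * c * K ^ \<bar>\<alpha>\<bar>\<^sub>m * (decay \<gamma> * decay \<epsilon>)) * (M (\<bar>\<alpha>\<bar>\<^sub>m - s) * W)"
    proof (intro mult_left_mono mult_mono MM WW)
      show "0 \<le> M (\<bar>\<alpha>\<bar>\<^sub>m - s)" using \<open>M (\<bar>\<alpha>\<bar>\<^sub>m - s) > 0\<close> by simp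
      show "0 \<le> c * q ^ (s - 1) * c * K ^ \<bar>\<alpha>\<bar>\<^sub>m * (decay \<gamma> * decay \<epsilon>)"
        using c q K decay_pos[of \<gamma>] decay_pos[of \<epsilon>] by simp
    qed (simp add: forest_weight_nonneg)
    also have "\<dots> = X * (decay \<gamma> * decay \<epsilon>)"
      by (simp add: X_def mult_ac)
    finally show ?thesis .
  qed
  have "cmod (mfps_nth (mpow g (\<beta> + axis i 1)) \<alpha>)
      \<le> (\<Sum>(\<gamma>, \<epsilon>) \<in> {(\<gamma>, \<epsilon>). \<gamma> + \<epsilon> = \<alpha>}. X * (decay \<gamma> * decay \<epsilon>))"
    unfolding mpow_add mpow_axis mfps_nth_mult
    by (rule sum_norm_le) (use summand in auto)
  also have "\<dots> = X * (\<Sum>(\<gamma>, \<epsilon>) \<in> {(\<gamma>, \<epsilon>). \<gamma> + \<epsilon> = \<alpha>}. decay \<gamma> * decay \<epsilon>)"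
    by (simp add: sum_distrib_left case_prod_unfold)
  also have "\<dots> \<le> X * (16 ^ CARD('n) * decay \<alpha>)"
    by (rule mult_left_mono[OF decay_convolution X])
  also have "\<dots> = c * (q ^ (s - 1) * q) * K ^ \<bar>\<alpha>\<bar>\<^sub>m * decay \<alpha> * M (\<bar>\<alpha>\<bar>\<^sub>m - s) * W"
    by (simp add: X_def q_def mult_ac)
  also have "q ^ (s - 1) * q = q ^ s"
    by (rule power_minus_mult) (use s in simp)
  finally show ?case
    using s by (simp add: W_def q_def mdeg_add mdeg_axis s_def[symmetric] del: One_nat_def)
qed

lemma mindex_mdeg_1:
  fixes \<alpha> :: "nat ^ 'n"
  assumes "\<bar>\<alpha>\<bar>\<^sub>m = 1"
  obtains i where "\<alpha> = axis i 1"
proof -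
  have "\<alpha> \<noteq> 0" using assms by (auto simp flip: mdeg_eq_0_iff)
  then obtain i where "\<alpha> $ i > 0" by (auto simp: vec_eq_iff)
  then obtain \<beta> where \<alpha>: "\<alpha> = \<beta> + axis i 1" by (rule mindex_split)
  then have "\<beta> = 0"
    using assms by (simp add: mdeg_add mdeg_axis mdeg_eq_0_iff del: One_nat_def)
  with \<alpha> that show thesis by simp
qed

lemma vid_nth:
  "mfps_nth (vid $ j) \<alpha> = (if \<alpha> = axis j 1 then 1 else 0)"
  by (simp add: vid_def mfps_X_def)

text \<open>
  For every \<open>s = |\<beta>| \<ge> 2\<close>, the weights \<open>M\<^sub>s M\<^bsub>|\<alpha>|+1-s\<^esub> \<le> M\<^bsub>|\<alpha>|\<^esub>\<close> combine to the right one, grafting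
  a root pays for the division by the divisor, and a factor \<open>B (B c 16\<^sup>n)\<^sup>s\<^sup>-\<^sup>1\<close> remains.  With
  \<open>B c 16\<^sup>n \<le> \<eta> / 2\<close> it is at most \<open>2 B \<eta> 2\<^sup>-\<^sup>s\<close>: the power of \<open>1 / 2\<close> makes the sum over \<open>\<beta>\<close>
  converge, and the small factor \<open>\<eta>\<close>, available because \<open>s - 1 \<ge> 1\<close>, makes the whole sum small.
  The condition \<open>c K M\<^sub>1 \<ge> 4\<close> lets the majorant dominate the identity map, since the decay factor of a
  unit vector is \<open>1 / 4\<close>.
\<close>

lemma linearization_step_bound:
  fixes f h :: "'n::finite vfps" and M :: "nat \<Rightarrow> real"
  assumes nonres: "\<not> resonant \<omega>" and f: "f \<in> V_space 1" and hV: "h \<in> V_space 1"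
    and M_pos: "\<And>k. k \<ge> 1 \<Longrightarrow> M k > 0"
    and M_mult: "\<And>k l. k \<ge> 1 \<Longrightarrow> l \<ge> 1 \<Longrightarrow> M k * M l \<le> M (k + l - 1)"
    and fb: "\<And>j \<beta>. \<bar>\<beta>\<bar>\<^sub>m \<ge> 2 \<Longrightarrow> cmod (mfps_nth (f $ j) \<beta>) \<le> A * B ^ \<bar>\<beta>\<bar>\<^sub>m * M \<bar>\<beta>\<bar>\<^sub>m"
    and A: "A > 0" and B: "B > 0" and c: "c > 0" and K: "K > 0"
    and \<eta>: "0 < \<eta>" "\<eta> \<le> 1" "B * (c * 16 ^ CARD('n)) \<le> \<eta> / 2" "A * B * \<eta> * 2 * 2 ^ CARD('n) \<le> 1"
    and cK: "c * K * M 1 \<ge> 4"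
    and hb: "\<And>j \<alpha>. \<bar>\<alpha>\<bar>\<^sub>m \<ge> 2 \<Longrightarrow>
      cmod (mfps_nth (h $ j) \<alpha>) \<le> c * K ^ \<bar>\<alpha>\<bar>\<^sub>m * decay \<alpha> * M \<bar>\<alpha>\<bar>\<^sub>m * forest_weight \<omega> 1 \<alpha>"
    and \<alpha>: "\<bar>\<alpha>\<bar>\<^sub>m \<ge> 2"
  shows "cmod (mfps_nth (linearization_step \<omega> f h $ j) \<alpha>)
    \<le> c * K ^ \<bar>\<alpha>\<bar>\<^sub>m * decay \<alpha> * M \<bar>\<alpha>\<bar>\<^sub>m * forest_weight \<omega> 1 \<alpha>"
proof -
  define a where "a = \<bar>\<alpha>\<bar>\<^sub>m"
  define q where "q = c * 16 ^ CARD('n)"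
  define \<delta> where "\<delta> = divisor_size \<omega> \<alpha>"
  define X where "X = c * K ^ a * decay \<alpha> * M a * forest_weight \<omega> 1 \<alpha>"
  have q: "q > 0" "B * q \<le> \<eta> / 2" using c \<eta> by (simp_all add: q_def)
  have Ma: "M a > 0" using \<alpha> by (auto simp: a_def intro: M_pos)
  have X: "X \<ge> 0"
    unfolding X_def using c K Ma decay_pos[of \<alpha>] forest_weight_nonneg[of \<omega> 1 \<alpha>] by simp
  obtain i where "\<delta> = cmod (small_divisor \<omega> i \<alpha>)"
    unfolding \<delta>_def using divisor_size_attained by blast
  then have \<delta>: "\<delta> > 0"
    using small_divisor_nonzero[OF nonres \<alpha>] by simp
  have g: "cmod (mfps_nth ((vid + h) $ i) \<gamma>)
      \<le> c * K ^ \<bar>\<gamma>\<bar>\<^sub>m * decay \<gamma> * M \<bar>\<gamma>\<bar>\<^sub>m * forest_weight \<omega> 1 \<gamma>" if \<gamma>: "\<bar>\<gamma>\<bar>\<^sub>m \<ge> 1" for i \<gamma>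
  proof (cases "\<bar>\<gamma>\<bar>\<^sub>m = 1")
    case True
    obtain k where k: "\<gamma> = axis k 1" using mindex_mdeg_1[OF True] .
    have "mfps_nth (h $ i) \<gamma> = 0" using hV True by (simp add: V_space_iff)
    then have "cmod (mfps_nth ((vid + h) $ i) \<gamma>) \<le> 1"
      by (simp add: mfps_nth_add vid_nth)
    also have "1 \<le> c * K * M 1 / 4" using cK by simp
    also have "\<dots> \<le> c * K * M 1 / 4 * forest_weight \<omega> 1 \<gamma>"
      using mult_left_mono[OF forest_weight_axis[of \<omega> k], of "c * K * M 1 / 4"] cK k by simp
    also have "c * K * M 1 / 4 = c * K ^ \<bar>\<gamma>\<bar>\<^sub>m * decay \<gamma> * M \<bar>\<gamma>\<bar>\<^sub>m"
      unfolding True unfolding k decay_axis by simp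
    finally show ?thesis .
  next
    case False
    then have "\<gamma> \<noteq> axis i 1" "\<bar>\<gamma>\<bar>\<^sub>m \<ge> 2" using \<gamma> by (auto simp: mdeg_axis simp del: One_nat_def)
    then show ?thesis using hb[of \<gamma> i] by (simp add: mfps_nth_add vid_nth del: One_nat_def)
  qed
  have summand: "cmod (mfps_nth (f $ j) \<beta> * mfps_nth (mpow (vid + h) \<beta>) \<alpha>)
      \<le> \<delta> * X * (A * B * \<eta> * 2) * (1 / 2) ^ \<bar>\<beta>\<bar>\<^sub>m"
    if \<beta>: "\<bar>\<beta>\<bar>\<^sub>m \<le> a" for \<beta>
  proof (cases "\<bar>\<beta>\<bar>\<^sub>m \<le> 1")
    case True
    then have "mfps_nth (f $ j) \<beta> = 0" using f by (simp add: V_space_iff)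
    then show ?thesis using \<delta> X A B \<eta> by simp
  next
    case False
    define s where "s = \<bar>\<beta>\<bar>\<^sub>m"
    have s: "s \<ge> 2" "s \<le> a" using False \<beta> by (simp_all add: s_def)
    have "\<beta> \<noteq> 0" using False by (auto simp flip: mdeg_eq_0_iff)
    have "cmod (mfps_nth (mpow (vid + h) \<beta>) \<alpha>)
        \<le> c * q ^ (s - 1) * K ^ a * decay \<alpha> * M (a + 1 - s) * forest_weight \<omega> s \<alpha>"
      unfolding a_def s_def q_def
      by (rule mpow_nth_bound[where M=M and g="vid + h", OF M_pos M_mult c K vid_add_nth_0[OF hV] g])
         (use s \<open>\<beta> \<noteq> 0\<close> in \<open>simp_all add: a_def s_def\<close>)
    moreover have "cmod (mfps_nth (f $ j) \<beta>) \<le> A * B ^ s * M s"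
      unfolding s_def by (rule fb) (use s in \<open>simp add: s_def\<close>)
    moreover have Ms: "M s > 0" "M (a + 1 - s) > 0" using s by (auto intro: M_pos)
    ultimately have "cmod (mfps_nth (f $ j) \<beta> * mfps_nth (mpow (vid + h) \<beta>) \<alpha>)
        \<le> (A * B ^ s * M s) * (c * q ^ (s - 1) * K ^ a * decay \<alpha> * M (a + 1 - s) * forest_weight \<omega> s \<alpha>)"
      unfolding norm_mult using A B by (intro mult_mono) auto
    also have "\<dots> = (A * B * (B * q) ^ (s - 1)) * (c * K ^ a * decay \<alpha>) *
        ((M s * M (a + 1 - s)) * forest_weight \<omega> s \<alpha>)"
      using s by (cases s) (simp_all add: power_mult_distrib mult_ac)
    also have "\<dots> \<le> (A * B * (\<eta> * 2 * (1 / 2) ^ s)) * (c * K ^ a * decay \<alpha>) *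
        (M a * (\<delta> * forest_weight \<omega> 1 \<alpha>))"
    proof (intro mult_mono mult_left_mono)
      \<comment> \<open>One factor of the small constant is kept; the others are bounded by 1.\<close>
      have "(B * q) ^ (s - 1) \<le> (\<eta> * (1 / 2)) ^ (s - 1)"
        using q B by (intro power_mono) auto
      also have "\<dots> \<le> \<eta> ^ 1 * (1 / 2) ^ (s - 1)"
        unfolding power_mult_distrib using \<eta> s by (intro mult_right_mono power_decreasing) auto
      also have "\<dots> = \<eta> * 2 * (1 / 2) ^ s"
        using s by (cases s) simp_all
      finally show "(B * q) ^ (s - 1) \<le> \<eta> * 2 * (1 / 2) ^ s" .
      show "M s * M (a + 1 - s) \<le> M a"
        using M_mult[of s "a + 1 - s"] s by simp
      show "forest_weight \<omega> s \<alpha> \<le> \<delta> * forest_weight \<omega> 1 \<alpha>"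
        using forest_weight_graft[OF s(1)] \<delta> by (simp add: \<delta>_def)
    qed (use A B c K q(1) \<eta>(1) Ma Ms decay_pos[of \<alpha>] \<delta> in \<open>auto simp: forest_weight_nonneg\<close>)
    also have "\<dots> = \<delta> * X * (A * B * \<eta> * 2) * (1 / 2) ^ s"
      by (simp add: X_def mult_ac)
    finally show ?thesis by (simp add: s_def)
  qed
  have "cmod (mfps_nth (vcompose f (vid + h) $ j) \<alpha>)
      \<le> (\<Sum>\<beta> :: nat ^ 'n | \<bar>\<beta>\<bar>\<^sub>m \<le> a. \<delta> * X * (A * B * \<eta> * 2) * (1 / 2) ^ \<bar>\<beta>\<bar>\<^sub>m)"
    unfolding mfps_nth_vcompose a_def[symmetric]
    by (rule sum_norm_le) (use summand in auto)
  also have "\<dots> = \<delta> * X * (A * B * \<eta> * 2) * (\<Sum>\<beta> :: nat ^ 'n | \<bar>\<beta>\<bar>\<^sub>m \<le> a. (1 / 2) ^ \<bar>\<beta>\<bar>\<^sub>m)"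
    by (simp add: sum_distrib_left)
  also have "\<dots> \<le> \<delta> * X * (A * B * \<eta> * 2) * 2 ^ CARD('n)"
    using sum_power_mdeg_le[of "1 / 2" a, where 'n='n] \<delta> X A B \<eta> by (intro mult_left_mono) auto
  also have "\<dots> = \<delta> * X * (A * B * \<eta> * 2 * 2 ^ CARD('n))"
    by simp
  also have "\<dots> \<le> \<delta> * X * 1"
    using \<delta> X \<eta> by (intro mult_left_mono) auto
  also have "\<dots> \<le> cmod (small_divisor \<omega> j \<alpha>) * X"
    using divisor_size_le[of \<omega> \<alpha> j] X by (simp add: \<delta>_def mult_right_mono)
  finally have "cmod (mfps_nth (vcompose f (vid + h) $ j) \<alpha>) \<le> cmod (small_divisor \<omega> j \<alpha>) * X" .
  then show ?thesis
    using \<alpha> small_divisor_nonzero[OF nonres \<alpha>, of j]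
    by (simp add: linearization_step_def norm_divide X_def a_def field_simps)
qed

text \<open>
  The constants are chosen in the order \<open>\<eta>\<close>, \<open>c\<close>, \<open>K\<close>: a small \<open>c\<close> makes the nonlinear terms small,
  and a large \<open>K\<close> compensates it on the linear part.
\<close>

lemma linearization_forest_bound:
  fixes f :: "'n::finite vfps" and M :: "nat \<Rightarrow> real"
  assumes nonres: "\<not> resonant \<omega>" and f: "f \<in> V_space 1"
    and M_pos: "\<And>k. k \<ge> 1 \<Longrightarrow> M k > 0"
    and M_mult: "\<And>k l. k \<ge> 1 \<Longrightarrow> l \<ge> 1 \<Longrightarrow> M k * M l \<le> M (k + l - 1)"
    and fb: "\<And>j \<beta>. \<bar>\<beta>\<bar>\<^sub>m \<ge> 2 \<Longrightarrow> cmod (mfps_nth (f $ j) \<beta>) \<le> A * B ^ \<bar>\<beta>\<bar>\<^sub>m * M \<bar>\<beta>\<bar>\<^sub>m"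
    and A: "A > 0" and B: "B > 0"
  obtains c K where "c > 0" "K > 0"
    "\<And>j \<alpha>. \<bar>\<alpha>\<bar>\<^sub>m \<ge> 2 \<Longrightarrow> cmod (mfps_nth (linearization (diag_mat \<omega>) f $ j) \<alpha>)
      \<le> c * K ^ \<bar>\<alpha>\<bar>\<^sub>m * M \<bar>\<alpha>\<bar>\<^sub>m * forest_weight \<omega> 1 \<alpha>"
proof -
  define \<eta> where "\<eta> = min 1 (1 / (A * B * 2 * 2 ^ CARD('n)))"
  define c where "c = \<eta> / (2 * B * 16 ^ CARD('n))"
  define K where "K = 4 / (c * M 1)"
  have \<eta>: "0 < \<eta>" "\<eta> \<le> 1" using A B by (auto simp: \<eta>_def)
  have "\<eta> \<le> 1 / (A * B * 2 * 2 ^ CARD('n))" by (simp add: \<eta>_def)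
  then have \<eta>4: "A * B * \<eta> * 2 * 2 ^ CARD('n) \<le> 1"
    using A B by (simp add: field_simps)
  have c: "c > 0" using \<eta> B by (simp add: c_def)
  have \<eta>3: "B * (c * 16 ^ CARD('n)) \<le> \<eta> / 2" using B by (simp add: c_def)
  have M1: "M 1 > 0" using M_pos by simp
  have K: "K > 0" using c M1 by (simp add: K_def)
  have cK: "c * K * M 1 \<ge> 4" using c M1 by (simp add: K_def)
  have approx: "cmod (mfps_nth (linearization_approx \<omega> f k $ j) \<alpha>)
      \<le> c * K ^ \<bar>\<alpha>\<bar>\<^sub>m * decay \<alpha> * M \<bar>\<alpha>\<bar>\<^sub>m * forest_weight \<omega> 1 \<alpha>"
    if "\<bar>\<alpha>\<bar>\<^sub>m \<ge> 2" for k j \<alpha>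
    using that
  proof (induction k arbitrary: j \<alpha>)
    case 0
    then show ?case
      using c K M_pos[of "\<bar>\<alpha>\<bar>\<^sub>m"] decay_pos[of \<alpha>] forest_weight_nonneg[of \<omega> 1 \<alpha>]
      by (simp add: zero_mfps_def)
  next
    case (Suc k)
    show ?case
      unfolding funpow.simps comp_apply
      by (rule linearization_step_bound[OF nonres f linearization_approx_in_V M_pos M_mult fb
            A B c K \<eta> \<eta>3 \<eta>4 cK Suc.IH Suc.prems])
  qed
  define h where "h = linearization (diag_mat \<omega>) f"
  have h: "h \<in> V_space 1" "linearization_step \<omega> f h = h"
    using linearization_is_linearization[OF nonres f]
    by (simp_all add: h_def is_linearization_iff[OF nonres f])
  have bound: "cmod (mfps_nth (h $ j) \<alpha>) \<le> c * K ^ \<bar>\<alpha>\<bar>\<^sub>m * M \<bar>\<alpha>\<bar>\<^sub>m * forest_weight \<omega> 1 \<alpha>"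
    if \<alpha>: "\<bar>\<alpha>\<bar>\<^sub>m \<ge> 2" for j \<alpha>
  proof -
    have "cmod (mfps_nth (h $ j) \<alpha>) \<le> c * K ^ \<bar>\<alpha>\<bar>\<^sub>m * decay \<alpha> * M \<bar>\<alpha>\<bar>\<^sub>m * forest_weight \<omega> 1 \<alpha>"
      using approx[OF \<alpha>, of "Suc \<bar>\<alpha>\<bar>\<^sub>m" j]
        linearization_step_fixpoint_agrees_approx[OF f h, of \<alpha> "Suc \<bar>\<alpha>\<bar>\<^sub>m" j]
      by (simp only: lessI)
    also have "\<dots> = decay \<alpha> * (c * K ^ \<bar>\<alpha>\<bar>\<^sub>m * M \<bar>\<alpha>\<bar>\<^sub>m * forest_weight \<omega> 1 \<alpha>)"
      by simp
    also have "\<dots> \<le> c * K ^ \<bar>\<alpha>\<bar>\<^sub>m * M \<bar>\<alpha>\<bar>\<^sub>m * forest_weight \<omega> 1 \<alpha>"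
      using c K M_pos[of "\<bar>\<alpha>\<bar>\<^sub>m"] \<alpha> forest_weight_nonneg[of \<omega> 1 \<alpha>] decay_pos[of \<alpha>]
      by (intro mult_left_le_one_le decay_le_1) auto
    finally show ?thesis .
  qed
  show thesis
    by (rule that[OF c K]) (use bound in \<open>simp add: h_def\<close>)
qed


section \<open>Bruno sums\<close>

text \<open>
  As \<open>\<Omega>(p)\<close> decreases in \<open>p\<close>, it either stays above 1 or is at most 1 from some index on.
\<close>

lemma Bruno_term_sign:
  assumes nonres: "\<not> resonant \<omega>" and p: "index_seq p"
  shows "(\<forall>m. Bruno_term \<omega> p m \<le> 0) \<or> (\<exists>m\<^sub>0. \<forall>m\<ge>m\<^sub>0. Bruno_term \<omega> p m \<ge> 0)"
proof -
  have mono: "strict_mono p" and p0: "p 0 > 0" using p by (auto simp: index_seq_def)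
  have p2: "p (m + 1) \<ge> 2" for m
    using strict_monoD[OF mono, of 0 "m + 1"] p0 by simp
  have pos: "Omega_hat \<omega> (p (m + 1)) > 0" for m
    by (rule Omega_hat_pos[OF nonres p2])
  show ?thesis
  proof (cases "\<exists>m\<^sub>0. Omega_hat \<omega> (p (m\<^sub>0 + 1)) \<le> 1")
    case True
    then obtain m\<^sub>0 where m0: "Omega_hat \<omega> (p (m\<^sub>0 + 1)) \<le> 1" ..
    have "Bruno_term \<omega> p m \<ge> 0" if "m \<ge> m\<^sub>0" for m
    proof -
      have "p (m\<^sub>0 + 1) \<le> p (m + 1)"
        using that by (simp add: strict_mono_less_eq[OF mono])
      from Omega_hat_antimono[OF nonres p2 this] m0 have "Omega_hat \<omega> (p (m + 1)) \<le> 1"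
        by linarith
      then show ?thesis
        using pos[of m] by (simp add: Bruno_term_def one_le_inverse_iff)
    qed
    then show ?thesis by blast
  next
    case False
    then have "Bruno_term \<omega> p m \<le> 0" for m
      using pos[of m] by (auto simp: Bruno_term_def not_le inverse_le_1_iff intro!: divide_nonpos_nonneg
          dest: spec[of _ m])
    then show ?thesis by blast
  qed
qed

text \<open>
  If the terms are never positive, the sum of the positive parts is 0, although the signed sum may
  tend to \<open>-\<infinity>\<close>; this is the reason for the maximum.  Otherwise the two sums differ by finitely many
  terms.
\<close>

lemma Bruno_sum_le:
  assumes "\<not> resonant \<omega>" "index_seq p"
  shows "\<exists>c. \<forall>k. Bruno_sum \<omega> p k \<le> max 0 ((\<Sum>m\<le>k. Bruno_term \<omega> p m) + c)"
  using Bruno_term_sign[OF assms]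
proof
  assume "\<forall>m. Bruno_term \<omega> p m \<le> 0"
  then have "Bruno_sum \<omega> p k = 0" for k
    unfolding Bruno_sum_def by (intro sum.neutral) (auto simp: max_def intro: antisym)
  then show ?thesis by (intro exI[of _ 0]) simp
next
  assume "\<exists>m\<^sub>0. \<forall>m\<ge>m\<^sub>0. Bruno_term \<omega> p m \<ge> 0"
  then obtain m\<^sub>0 where m0: "\<And>m. m \<ge> m\<^sub>0 \<Longrightarrow> Bruno_term \<omega> p m \<ge> 0" by blast
  define c where "c = (\<Sum>m<m\<^sub>0. \<bar>Bruno_term \<omega> p m\<bar>)"
  have "Bruno_sum \<omega> p k \<le> max 0 ((\<Sum>m\<le>k. Bruno_term \<omega> p m) + c)" for k
  proof -
    have "Bruno_sum \<omega> p k \<le> (\<Sum>m\<le>k. Bruno_term \<omega> p m + (if m \<in> {..<m\<^sub>0} then \<bar>Bruno_term \<omega> p m\<bar> else 0))"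
      unfolding Bruno_sum_def by (rule sum_mono) (use m0 in \<open>auto simp: not_less\<close>)
    also have "\<dots> = (\<Sum>m\<le>k. Bruno_term \<omega> p m) + (\<Sum>m\<in>{..k} \<inter> {..<m\<^sub>0}. \<bar>Bruno_term \<omega> p m\<bar>)"
      by (simp add: sum.distrib sum.inter_restrict)
    also have "\<dots> \<le> (\<Sum>m\<le>k. Bruno_term \<omega> p m) + c"
      unfolding c_def by (intro add_left_mono sum_mono2) auto
    finally show ?thesis by simp
  qed
  then show ?thesis by blast
qed

text \<open>
  From \<open>m\<^sub>0\<close> on the partial sums increase, so in the extended reals they converge to their supremum,
  which is the sum of the series.
\<close>

lemma partial_sums_bounded_of_ereal_suminf:
  fixes t :: "nat \<Rightarrow> real"
  assumes nonneg: "\<And>m. m \<ge> m\<^sub>0 \<Longrightarrow> t m \<ge> 0" and fin: "(\<Sum>k. ereal (t k)) < \<infinity>"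
  shows "\<exists>C. \<forall>k. (\<Sum>m\<le>k. t m) \<le> C"
proof -
  define X where "X k = ereal (\<Sum>m<k + m\<^sub>0. t m)" for k
  have "incseq X"
    by (rule incseq_SucI) (simp add: X_def nonneg)
  then have "X \<longlonglongrightarrow> (SUP k. X k)" by (rule LIMSEQ_SUP)
  then have "(\<lambda>k. ereal (\<Sum>m<k. t m)) \<longlonglongrightarrow> (SUP k. X k)"
    unfolding X_def by (rule LIMSEQ_offset)
  then have "(\<lambda>k. ereal (t k)) sums (SUP k. X k)"
    by (simp add: sums_def)
  with fin have "(SUP k. X k) < \<infinity>" by (simp add: sums_iff)
  moreover have up: "X k \<le> (SUP k. X k)" for k by (rule SUP_upper) simp
  ultimately obtain L where L: "(SUP k. X k) = ereal L"
    using up[of 0] by (cases "SUP k. X k") (auto simp: X_def)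
  have "(\<Sum>m\<le>k. t m) \<le> max L (\<Sum>m<m\<^sub>0. \<bar>t m\<bar>)" for k
  proof (cases "m\<^sub>0 \<le> Suc k")
    case True
    then have "X (Suc k - m\<^sub>0) = ereal (\<Sum>m\<le>k. t m)"
      by (simp add: X_def lessThan_Suc_atMost)
    with up[of "Suc k - m\<^sub>0"] L show ?thesis by simp
  next
    case False
    have "(\<Sum>m\<le>k. t m) \<le> (\<Sum>m\<le>k. \<bar>t m\<bar>)" by (rule sum_mono) simp
    also have "\<dots> \<le> (\<Sum>m<m\<^sub>0. \<bar>t m\<bar>)" using False by (intro sum_mono2) auto
    finally show ?thesis by simp
  qed
  then show ?thesis by blast
qed

lemma Bruno_sum_bounded:
  assumes "\<not> resonant \<omega>" "index_seq p" "Bruno_condition \<omega> p"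
  shows "\<exists>C. \<forall>k. Bruno_sum \<omega> p k \<le> C"
  using Bruno_term_sign[OF assms(1,2)]
proof
  assume "\<forall>m. Bruno_term \<omega> p m \<le> 0"
  then have "Bruno_sum \<omega> p k = 0" for k
    unfolding Bruno_sum_def by (intro sum.neutral) (auto simp: max_def intro: antisym)
  then show ?thesis by (intro exI[of _ 0]) simp
next
  assume "\<exists>m\<^sub>0. \<forall>m\<ge>m\<^sub>0. Bruno_term \<omega> p m \<ge> 0"
  then obtain C where C: "\<And>k. (\<Sum>m\<le>k. Bruno_term \<omega> p m) \<le> C"
    using partial_sums_bounded_of_ereal_suminf assms(3) unfolding Bruno_condition_def by metis
  obtain c where c: "\<And>k. Bruno_sum \<omega> p k \<le> max 0 ((\<Sum>m\<le>k. Bruno_term \<omega> p m) + c)"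
    using Bruno_sum_le[OF assms(1,2)] by blast
  have "Bruno_sum \<omega> p k \<le> max 0 (C + c)" for k
    using c[of k] C[of k] by linarith
  then show ?thesis by blast
qed


section \<open>Growth classes\<close>

lemma growth_classI_eventually:
  fixes f :: "'n::finite vfps"
  assumes N_pos: "\<And>k. k \<ge> 1 \<Longrightarrow> N k > 0" and B: "B > 0"
    and bound: "\<And>\<alpha>. \<bar>\<alpha>\<bar>\<^sub>m \<ge> d \<Longrightarrow> norm (vcoeff f \<alpha>) \<le> D * B ^ \<bar>\<alpha>\<bar>\<^sub>m * N \<bar>\<alpha>\<bar>\<^sub>m"
  shows "f \<in> growth_class N"
proof -
  define r where "r \<alpha> = norm (vcoeff f \<alpha>) / (B ^ \<bar>\<alpha>\<bar>\<^sub>m * N \<bar>\<alpha>\<bar>\<^sub>m)" for \<alpha>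
  define S where "S = {\<alpha> :: nat ^ 'n. \<bar>\<alpha>\<bar>\<^sub>m \<ge> 1 \<and> \<bar>\<alpha>\<bar>\<^sub>m \<le> d}"
  have fin: "finite S" unfolding S_def by (rule finite_subset[OF _ finite_mdeg_le[of d]]) auto
  have r0: "r \<alpha> \<ge> 0" if "\<bar>\<alpha>\<bar>\<^sub>m \<ge> 1" for \<alpha> using N_pos[OF that] B by (simp add: r_def)
  define E where "E = \<bar>D\<bar> + (\<Sum>\<alpha>\<in>S. r \<alpha>) + 1"
  have sum0: "(\<Sum>\<alpha>\<in>S. r \<alpha>) \<ge> 0" by (rule sum_nonneg) (simp add: r0 S_def)
  have "norm (vcoeff f \<alpha>) \<le> E * B ^ \<bar>\<alpha>\<bar>\<^sub>m * N \<bar>\<alpha>\<bar>\<^sub>m" if \<alpha>: "\<bar>\<alpha>\<bar>\<^sub>m \<ge> 1" for \<alpha>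
  proof -
    have pos: "B ^ \<bar>\<alpha>\<bar>\<^sub>m * N \<bar>\<alpha>\<bar>\<^sub>m > 0" using N_pos[OF \<alpha>] B by simp
    have "r \<alpha> \<le> E"
    proof (cases "\<bar>\<alpha>\<bar>\<^sub>m \<ge> d")
      case True
      then have "r \<alpha> \<le> D"
        using bound[OF True] pos by (simp add: r_def pos_divide_le_eq mult.assoc)
      then show ?thesis using sum0 by (simp add: E_def)
    next
      case False
      then have "r \<alpha> \<le> (\<Sum>\<alpha>\<in>S. r \<alpha>)"
        using \<alpha> by (intro member_le_sum fin) (auto simp: S_def r0)
      then show ?thesis by (simp add: E_def)
    qed
    then show ?thesis
      using pos by (simp add: r_def pos_divide_le_eq mult.assoc)
  qed
  moreover have "E > 0" using sum0 by (simp add: E_def)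
  ultimately show ?thesis using B by (auto simp: growth_class_def)
qed

lemma norm_vcoeff_le: "norm (vcoeff f \<alpha>) \<le> (\<Sum>j\<in>UNIV. cmod (mfps_nth (f $ j) \<alpha>))"
  unfolding norm_vec_def by (rule order_trans[OF L2_set_le_sum]) (simp_all add: vcoeff_def)

lemma cmod_mfps_nth_le: "cmod (mfps_nth (f $ j) \<alpha>) \<le> norm (vcoeff f \<alpha>)"
proof -
  have "norm (vcoeff f \<alpha> $ j) \<le> norm (vcoeff f \<alpha>)" by (rule Finite_Cartesian_Product.norm_nth_le)
  then show ?thesis by (simp add: vcoeff_def)
qed

lemma linearization_in_growth_class:
  fixes f :: "'n::finite vfps" and M N :: "nat \<Rightarrow> real"
  assumes nonres: "\<not> resonant \<omega>" and f: "f \<in> V_space 1"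
    and M_pos: "\<And>k. k \<ge> 1 \<Longrightarrow> M k > 0"
    and M_mult: "\<And>k l. k \<ge> 1 \<Longrightarrow> l \<ge> 1 \<Longrightarrow> M k * M l \<le> M (k + l - 1)"
    and fM: "f \<in> growth_class M"
    and N_pos: "\<And>k. k \<ge> 1 \<Longrightarrow> N k > 0" and p: "index_seq p"
    and MN: "\<forall>\<^sub>F \<alpha> :: nat ^ 'n in at_infinite_degree.
      M \<bar>\<alpha>\<bar>\<^sub>m * exp (2 * real \<bar>\<alpha>\<bar>\<^sub>m * Bruno_sum \<omega> p (kappa p \<alpha>)) \<le> exp (b * real \<bar>\<alpha>\<bar>\<^sub>m) * N \<bar>\<alpha>\<bar>\<^sub>m"
  shows "linearization (diag_mat \<omega>) f \<in> growth_class N"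
proof -
  define h where "h = linearization (diag_mat \<omega>) f"
  obtain A B where AB: "A > 0" "B > 0"
      "\<And>\<alpha>. \<bar>\<alpha>\<bar>\<^sub>m \<ge> 1 \<Longrightarrow> norm (vcoeff f \<alpha>) \<le> A * B ^ \<bar>\<alpha>\<bar>\<^sub>m * M \<bar>\<alpha>\<bar>\<^sub>m"
    using fM by (auto simp: growth_class_def)
  have fb: "cmod (mfps_nth (f $ j) \<beta>) \<le> A * B ^ \<bar>\<beta>\<bar>\<^sub>m * M \<bar>\<beta>\<bar>\<^sub>m" if "\<bar>\<beta>\<bar>\<^sub>m \<ge> 2" for j \<beta>
    using order_trans[OF cmod_mfps_nth_le[of f j \<beta>] AB(3)[of \<beta>]] that by simp
  obtain c K where cK: "c > 0" "K > 0"
    and hb: "\<And>j \<alpha>. \<bar>\<alpha>\<bar>\<^sub>m \<ge> 2 \<Longrightarrow> cmod (mfps_nth (h $ j) \<alpha>) \<le> c * K ^ \<bar>\<alpha>\<bar>\<^sub>m * M \<bar>\<alpha>\<bar>\<^sub>m * forest_weight \<omega> 1 \<alpha>"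
    unfolding h_def using linearization_forest_bound[OF nonres f M_pos M_mult fb AB(1,2)] by metis
  define C where "C = ln 2 + max 0 (ln (inverse (Omega_hat \<omega> (p 1))))"
  obtain d where d: "\<And>\<alpha> :: nat ^ 'n. \<bar>\<alpha>\<bar>\<^sub>m \<ge> d \<Longrightarrow>
      M \<bar>\<alpha>\<bar>\<^sub>m * exp (2 * real \<bar>\<alpha>\<bar>\<^sub>m * Bruno_sum \<omega> p (kappa p \<alpha>)) \<le> exp (b * real \<bar>\<alpha>\<bar>\<^sub>m) * N \<bar>\<alpha>\<bar>\<^sub>m"
    using MN by (auto simp: at_infinite_degree_def eventually_filtercomap eventually_at_top_linorder)
  have bound: "norm (vcoeff h \<alpha>) \<le> (real CARD('n) * c) * (K * exp C * exp b) ^ \<bar>\<alpha>\<bar>\<^sub>m * N \<bar>\<alpha>\<bar>\<^sub>m"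
    if \<alpha>: "\<bar>\<alpha>\<bar>\<^sub>m \<ge> max (max 2 (p 0)) d" for \<alpha>
  proof -
    define a where "a = \<bar>\<alpha>\<bar>\<^sub>m"
    define S where "S = Bruno_sum \<omega> p (kappa p \<alpha>)"
    have Ma: "M a > 0" using \<alpha> by (intro M_pos) (simp add: a_def)
    have "cmod (mfps_nth (h $ j) \<alpha>) \<le> c * (K * exp C * exp b) ^ a * N a" for j
    proof -
      have "cmod (mfps_nth (h $ j) \<alpha>) \<le> c * K ^ a * M a * forest_weight \<omega> 1 \<alpha>"
        unfolding a_def using \<alpha> by (intro hb) simp
      also have "\<dots> \<le> c * K ^ a * M a * exp (real a * (C + 2 * S))"
        unfolding a_def C_def S_def
        by (intro mult_left_mono forest_weight_Bruno_bound[OF nonres p])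
           (use \<alpha> cK Ma in \<open>auto simp: a_def\<close>)
      also have "\<dots> = c * K ^ a * exp C ^ a * (M a * exp (2 * real a * S))"
        by (simp add: distrib_left exp_add mult_ac flip: exp_of_nat2_mult)
      also have "\<dots> \<le> c * K ^ a * exp C ^ a * (exp (b * real a) * N a)"
        unfolding a_def S_def using \<alpha> cK by (intro mult_left_mono d) auto
      also have "\<dots> = c * (K * exp C * exp b) ^ a * N a"
        by (simp add: power_mult_distrib exp_of_nat2_mult)
      finally show ?thesis .
    qed
    then have "(\<Sum>j\<in>UNIV. cmod (mfps_nth (h $ j) \<alpha>)) \<le> (\<Sum>j\<in>(UNIV :: 'n set). c * (K * exp C * exp b) ^ a * N a)"
      by (intro sum_mono)
    with norm_vcoeff_le[of h \<alpha>] show ?thesis by (simp add: a_def mult.assoc)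
  qed
  show ?thesis
    unfolding h_def[symmetric]
    by (rule growth_classI_eventually[where d="max (max 2 (p 0)) d", OF N_pos _ bound]) (use cK in simp_all)
qed

lemma eventually_mdeg_ge: "\<forall>\<^sub>F \<alpha> :: nat ^ 'n in at_infinite_degree. \<bar>\<alpha>\<bar>\<^sub>m \<ge> d"
  unfolding at_infinite_degree_def by (rule eventually_filtercomapI) (rule eventually_ge_at_top)

text \<open>
  The hypothesis on the upper limit bounds \<open>2 |\<alpha>|\<close> times the signed Bruno sum by
  \<open>C |\<alpha>| + log (N\<^bsub>|\<alpha>|\<^esub> / M\<^bsub>|\<alpha>|\<^esub>)\<close>, whose exponential turns \<open>M\<close> into \<open>N\<close>.  The comparison of \<open>M\<close>
  with \<open>N\<close> up to a geometric factor covers the degrees in which the sum of the positive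
  parts vanishes.
\<close>

lemma linearization_in_growth_class_Limsup:
  fixes f :: "'n::finite vfps" and M N :: "nat \<Rightarrow> real"
  assumes nonres: "\<not> resonant \<omega>" and f: "f \<in> V_space 1"
    and M_pos: "\<And>k. k \<ge> 1 \<Longrightarrow> M k > 0"
    and M_mult: "\<And>k l. k \<ge> 1 \<Longrightarrow> l \<ge> 1 \<Longrightarrow> M k * M l \<le> M (k + l - 1)"
    and fM: "f \<in> growth_class M"
    and N_pos: "\<And>k. k \<ge> 1 \<Longrightarrow> N k > 0" and p: "index_seq p"
    and MN: "\<forall>\<^sub>F k in sequentially. M k \<le> exp (b * real k) * N k"
    and limsup: "Limsup at_infinite_degree (\<lambda>\<alpha> :: nat ^ 'n.
      ereal (2 * (\<Sum>m=0..kappa p \<alpha>. Bruno_term \<omega> p m) - 1 / real \<bar>\<alpha>\<bar>\<^sub>m * ln (N \<bar>\<alpha>\<bar>\<^sub>m / M \<bar>\<alpha>\<bar>\<^sub>m))) < \<infinity>"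
  shows "linearization (diag_mat \<omega>) f \<in> growth_class N"
proof -
  obtain c where c: "\<And>k. Bruno_sum \<omega> p k \<le> max 0 ((\<Sum>m\<le>k. Bruno_term \<omega> p m) + c)"
    using Bruno_sum_le[OF nonres p] by blast
  obtain C where C: "Limsup at_infinite_degree (\<lambda>\<alpha> :: nat ^ 'n.
      ereal (2 * (\<Sum>m=0..kappa p \<alpha>. Bruno_term \<omega> p m) - 1 / real \<bar>\<alpha>\<bar>\<^sub>m * ln (N \<bar>\<alpha>\<bar>\<^sub>m / M \<bar>\<alpha>\<bar>\<^sub>m))) < ereal C"
    using ereal_dense2[OF limsup] by blast
  define e where "e = max b (C + 2 * c)"
  have "\<forall>\<^sub>F \<alpha> :: nat ^ 'n in at_infinite_degree. M \<bar>\<alpha>\<bar>\<^sub>m \<le> exp (b * real \<bar>\<alpha>\<bar>\<^sub>m) * N \<bar>\<alpha>\<bar>\<^sub>m"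
    unfolding at_infinite_degree_def using MN by (rule eventually_filtercomapI)
  with Limsup_lessD[OF C] eventually_mdeg_ge[of 1]
  have ev: "\<forall>\<^sub>F \<alpha> :: nat ^ 'n in at_infinite_degree.
      M \<bar>\<alpha>\<bar>\<^sub>m * exp (2 * real \<bar>\<alpha>\<bar>\<^sub>m * Bruno_sum \<omega> p (kappa p \<alpha>)) \<le> exp (e * real \<bar>\<alpha>\<bar>\<^sub>m) * N \<bar>\<alpha>\<bar>\<^sub>m"
  proof eventually_elim
    case (elim \<alpha>)
    define a where "a = \<bar>\<alpha>\<bar>\<^sub>m"
    define S where "S = Bruno_sum \<omega> p (kappa p \<alpha>)"
    define T where "T = (\<Sum>m\<le>kappa p \<alpha>. Bruno_term \<omega> p m)"
    have a: "real a > 0" using elim(2) by (simp add: a_def)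
    have pos: "M a > 0" "N a > 0" using elim(2) by (auto simp: a_def intro: M_pos N_pos)
    have "2 * T - ln (N a / M a) / real a < C"
      using elim(1) by (simp add: T_def a_def atLeast0AtMost)
    then have T: "2 * real a * T \<le> C * real a + ln (N a / M a)"
      using a by (simp add: field_simps)
    have S: "S \<le> 0 \<or> S \<le> T + c"
      using c[of "kappa p \<alpha>"] by (auto simp: S_def T_def)
    then have "M a * exp (2 * real a * S) \<le> exp (e * real a) * N a"
    proof
      assume "S \<le> 0"
      then have "exp (2 * real a * S) \<le> 1"
        using a by (simp add: mult_le_0_iff)
      then have "M a * exp (2 * real a * S) \<le> M a"
        using pos by simp
      also have "\<dots> \<le> exp (b * real a) * N a"
        using elim(3) by (simp add: a_def)
      also have "\<dots> \<le> exp (e * real a) * N a"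
        using pos a by (intro mult_right_mono) (auto simp: e_def)
      finally show ?thesis .
    next
      assume "S \<le> T + c"
      then have "2 * real a * S \<le> 2 * real a * (T + c)"
        using a by simp
      also have "\<dots> \<le> (C + 2 * c) * real a + ln (N a / M a)"
        using T by (simp add: algebra_simps)
      also have "\<dots> \<le> e * real a + ln (N a / M a)"
        using a by (intro add_right_mono mult_right_mono) (auto simp: e_def)
      finally have "exp (2 * real a * S) \<le> exp (e * real a + ln (N a / M a))"
        by simp
      also have "\<dots> = exp (e * real a) * (N a / M a)"
        using pos by (simp add: exp_add)
      finally show ?thesis
        using pos by (simp add: field_simps)
    qed
    then show ?case by (simp add: a_def S_def)
  qed
  show ?thesis
    by (rule linearization_in_growth_class[OF nonres f M_pos M_mult fM N_pos p ev])
qed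

text \<open>
  The terms of a series that converges at distance \<open>\<rho> > 0\<close> from the centre in every coordinate are
  bounded, so its coefficients are \<open>O(\<rho>\<^bsup>-|\<alpha>|\<^esup>)\<close>.
\<close>

lemma has_power_series_at_growth:
  fixes F :: "'n::finite vfps"
  assumes "has_power_series_at G F a"
  shows "F \<in> growth_class (\<lambda>_. 1)"
proof -
  obtain r where r: "r > 0"
    and conv: "\<And>z. z \<in> ball a r \<Longrightarrow> ((\<lambda>\<alpha>. mpow (z - a) \<alpha> *s vcoeff F \<alpha>) has_sum G z) UNIV"
    using assms by (auto simp: has_power_series_at_def)
  define \<rho> where "\<rho> = r / (2 * real CARD('n))"
  have \<rho>: "\<rho> > 0" using r by (simp add: \<rho>_def)
  define w :: "complex ^ 'n" where "w = (\<chi> i. complex_of_real \<rho>)"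
  have "norm w \<le> (\<Sum>i\<in>(UNIV :: 'n set). norm (w $ i))"
    unfolding norm_vec_def by (rule L2_set_le_sum) simp
  also have "\<dots> = real CARD('n) * \<rho>" using \<rho> by (simp add: w_def)
  also have "\<dots> = r / 2" by (simp add: \<rho>_def)
  finally have "a + w \<in> ball a r" using r by (simp add: dist_norm)
  from conv[OF this] have sum: "((\<lambda>\<alpha>. mpow w \<alpha> *s vcoeff F \<alpha>) has_sum G (a + w)) UNIV"
    by simp
  have w: "mpow w \<alpha> = complex_of_real \<rho> ^ \<bar>\<alpha>\<bar>\<^sub>m" for \<alpha>
    by (simp add: mpow_def w_def mdeg_def power_sum)
  have "\<exists>D. \<forall>\<alpha>. cmod (mfps_nth (F $ j) \<alpha>) \<le> D * (1 / \<rho>) ^ \<bar>\<alpha>\<bar>\<^sub>m" for j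
  proof -
    let ?t = "\<lambda>\<alpha>. complex_of_real \<rho> ^ \<bar>\<alpha>\<bar>\<^sub>m * mfps_nth (F $ j) \<alpha>"
    have "(?t has_sum G (a + w) $ j) UNIV"
      using has_sum_bounded_linear[OF bounded_linear_vec_nth sum, of j]
      by (simp add: comp_def vcoeff_def w)
    then have "?t summable_on UNIV" by (rule has_sum_imp_summable)
    then have abs: "(\<lambda>\<alpha>. norm (?t \<alpha>)) summable_on UNIV"
      by (simp add: summable_on_iff_abs_summable_on_complex)
    have "cmod (mfps_nth (F $ j) \<alpha>) \<le> infsum (\<lambda>\<alpha>. norm (?t \<alpha>)) UNIV * (1 / \<rho>) ^ \<bar>\<alpha>\<bar>\<^sub>m" for \<alpha>
    proof -
      have "norm (?t \<alpha>) \<le> infsum (\<lambda>\<alpha>. norm (?t \<alpha>)) UNIV"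
        using finite_sum_le_infsum[OF abs, of "{\<alpha>}"] by simp
      then show ?thesis
        using \<rho> by (simp add: norm_mult norm_power power_one_over field_simps)
    qed
    then show ?thesis by blast
  qed
  then obtain D where D: "\<And>j \<alpha>. cmod (mfps_nth (F $ j) \<alpha>) \<le> D j * (1 / \<rho>) ^ \<bar>\<alpha>\<bar>\<^sub>m" by metis
  have bound: "norm (vcoeff F \<alpha>) \<le> (\<Sum>j\<in>UNIV. D j) * (1 / \<rho>) ^ \<bar>\<alpha>\<bar>\<^sub>m * 1" for \<alpha>
    using order_trans[OF norm_vcoeff_le sum_mono[OF D]] by (simp add: sum_distrib_right)
  show ?thesis
    by (rule growth_classI_eventually[where d=0, OF _ _ bound]) (use \<rho> in simp_all)
qed


section \<open>Linearization in classes of formal power series\<close>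

lemma nonlinear_part_in_growth_class:
  fixes f :: "'n::finite vfps"
  assumes "f \<in> V_space 1" "mat_apply (diag_mat \<omega>) vid + f \<in> growth_class M"
    and M_pos: "\<And>k. k \<ge> 1 \<Longrightarrow> M k > 0"
  shows "f \<in> growth_class M"
proof -
  obtain A B where AB: "A > 0" "B > 0"
      "\<And>\<alpha>. \<bar>\<alpha>\<bar>\<^sub>m \<ge> 1 \<Longrightarrow> norm (vcoeff (mat_apply (diag_mat \<omega>) vid + f) \<alpha>) \<le> A * B ^ \<bar>\<alpha>\<bar>\<^sub>m * M \<bar>\<alpha>\<bar>\<^sub>m"
    using assms(2) by (auto simp: growth_class_def)
  have "norm (vcoeff f \<alpha>) \<le> A * B ^ \<bar>\<alpha>\<bar>\<^sub>m * M \<bar>\<alpha>\<bar>\<^sub>m" if \<alpha>: "\<bar>\<alpha>\<bar>\<^sub>m \<ge> 2" for \<alpha>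
  proof -
    have "\<alpha> \<noteq> axis j 1" for j using \<alpha> by (auto simp: mdeg_axis simp del: One_nat_def)
    then have "vcoeff (mat_apply (diag_mat \<omega>) vid + f) \<alpha> = vcoeff f \<alpha>"
      by (intro vec_eq_iff[THEN iffD2] allI)
         (simp add: vcoeff_def mfps_nth_add mat_apply_diag mfps_nth_const_mult vid_nth del: One_nat_def)
    with AB(3)[of \<alpha>] \<alpha> show ?thesis by simp
  qed
  with M_pos AB(2) show ?thesis by (rule growth_classI_eventually)
qed

lemma weight_seqD:
  assumes "weight_seq M"
  shows "k \<ge> 1 \<Longrightarrow> M k > 0" "k \<ge> 1 \<Longrightarrow> l \<ge> 1 \<Longrightarrow> M k * M l \<le> M (k + l - 1)"
  using assms by (auto simp: weight_seq_def)

lemma weight_seq_exponential_lower_bound: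
  assumes "weight_seq N"
  obtains b where "\<And>k. k \<ge> 1 \<Longrightarrow> 1 \<le> exp (b * real k) * N k"
proof
  define i where "i = (INF k\<in>{1..}. N k powr (1 / real k))"
  have i: "i > 0" using assms by (simp add: weight_seq_def i_def)
  fix k :: nat assume k: "k \<ge> 1"
  have N: "N k > 0" using weight_seqD(1)[OF assms k] .
  have "i \<le> N k powr (1 / real k)"
    unfolding i_def by (rule cINF_lower) (use k in \<open>auto intro!: bdd_belowI2[of _ 0]\<close>)
  then have "i powr real k \<le> (N k powr (1 / real k)) powr real k"
    using i by (intro powr_mono2) auto
  also have "\<dots> = N k" using N k by (simp add: powr_powr)
  finally have "exp (real k * ln i) \<le> N k" using i by (simp add: powr_def)
  then have "exp (- (real k * ln i)) * exp (real k * ln i) \<le> exp (- (real k * ln i)) * N k"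
    by (intro mult_left_mono) auto
  then show "1 \<le> exp (- ln i * real k) * N k"
    by (simp add: mult.commute flip: exp_add)
qed

theorem theorem5p2:
  fixes \<omega> :: "complex ^ 'n" and A :: "complex ^ 'n ^ 'n"
    and M N :: "nat \<Rightarrow> real"
    and F f h :: "'n vfps"
  assumes "A = diag_mat \<omega>" and "invertible A" and "\<not> resonant \<omega>"
    and "weight_seq M" and "weight_seq N"
    and "F \<in> V_space 0" and "f \<in> V_space 1" and "F = mat_apply A vid + f"
    and "h = linearization A f"
  shows
    "(F \<in> growth_class M \<inter> V_space 0 \<and>
       (\<exists>p. index_seq p \<and> Bruno_condition \<omega> p)
      \<longrightarrow> h \<in> growth_class M \<inter> V_space 1)
   \<and> (germ_analytic_diffeo F \<and>
       (\<exists>p. index_seq p \<and>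
          Limsup at_infinite_degree
            (\<lambda>\<alpha> :: nat ^ 'n. ereal (2 * (\<Sum>m=0..kappa p \<alpha>. Bruno_term \<omega> p m)
                    - 1 / real \<bar>\<alpha>\<bar>\<^sub>m * ln (N \<bar>\<alpha>\<bar>\<^sub>m))) < \<infinity>)
      \<longrightarrow> h \<in> growth_class N \<inter> V_space 1)
   \<and> (F \<in> growth_class M \<inter> V_space 0 \<and>
       (\<forall>\<^sub>F k in sequentially. M k \<le> N k) \<and>
       (\<exists>p. index_seq p \<and>
          Limsup at_infinite_degree
            (\<lambda>\<alpha> :: nat ^ 'n. ereal (2 * (\<Sum>m=0..kappa p \<alpha>. Bruno_term \<omega> p m)
                    - 1 / real \<bar>\<alpha>\<bar>\<^sub>m * ln (N \<bar>\<alpha>\<bar>\<^sub>m / M \<bar>\<alpha>\<bar>\<^sub>m))) < \<infinity>)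
      \<longrightarrow> h \<in> growth_class N \<inter> V_space 1)"
proof -
  note nonres = assms(3) and f = assms(7)
  note M = weight_seqD[OF assms(4)] and N = weight_seqD[OF assms(5)]
  have h: "h = linearization (diag_mat \<omega>) f" and F: "F = mat_apply (diag_mat \<omega>) vid + f"
    using assms(1,8,9) by simp_all
  have V: "h \<in> V_space 1"
    using linearization_is_linearization[OF nonres f] by (simp add: h is_linearization_def)
  have fM: "f \<in> growth_class M" if "F \<in> growth_class M"
    using nonlinear_part_in_growth_class[OF f _ M(1)] that by (simp add: F)
  show ?thesis
  proof (intro conjI impI)
    assume "F \<in> growth_class M \<inter> V_space 0 \<and> (\<exists>p. index_seq p \<and> Bruno_condition \<omega> p)"
    then obtain p where FM: "F \<in> growth_class M" and p: "index_seq p" "Bruno_condition \<omega> p"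
      by blast
    obtain C where C: "\<And>k. Bruno_sum \<omega> p k \<le> C"
      using Bruno_sum_bounded[OF nonres p] by blast
    have ev: "\<forall>\<^sub>F \<alpha> :: nat ^ 'n in at_infinite_degree.
        M \<bar>\<alpha>\<bar>\<^sub>m * exp (2 * real \<bar>\<alpha>\<bar>\<^sub>m * Bruno_sum \<omega> p (kappa p \<alpha>)) \<le> exp (2 * C * real \<bar>\<alpha>\<bar>\<^sub>m) * M \<bar>\<alpha>\<bar>\<^sub>m"
      using eventually_mdeg_ge[of 1]
    proof eventually_elim
      case (elim \<alpha>)
      have "2 * real \<bar>\<alpha>\<bar>\<^sub>m * Bruno_sum \<omega> p (kappa p \<alpha>) \<le> 2 * real \<bar>\<alpha>\<bar>\<^sub>m * C"
        by (intro mult_left_mono C) simp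
      then show ?case
        using M(1)[OF elim] by (simp add: mult_ac)
    qed
    have "h \<in> growth_class M"
      unfolding h by (rule linearization_in_growth_class[OF nonres f M fM[OF FM] M(1) p(1) ev])
    with V show "h \<in> growth_class M \<inter> V_space 1" by blast
  next
    assume "germ_analytic_diffeo F \<and> (\<exists>p. index_seq p \<and>
      Limsup at_infinite_degree
        (\<lambda>\<alpha> :: nat ^ 'n. ereal (2 * (\<Sum>m=0..kappa p \<alpha>. Bruno_term \<omega> p m)
          - 1 / real \<bar>\<alpha>\<bar>\<^sub>m * ln (N \<bar>\<alpha>\<bar>\<^sub>m))) < \<infinity>)"
    then obtain p G where p: "index_seq p" and G: "has_power_series_at G F 0"
      and limsup: "Limsup at_infinite_degree
        (\<lambda>\<alpha> :: nat ^ 'n. ereal (2 * (\<Sum>m=0..kappa p \<alpha>. Bruno_term \<omega> p m)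
          - 1 / real \<bar>\<alpha>\<bar>\<^sub>m * ln (N \<bar>\<alpha>\<bar>\<^sub>m / 1))) < \<infinity>"
      by (auto simp: germ_analytic_diffeo_def)
    \<comment> \<open>The expansion of an analytic map lies in the class of the constant weight 1, which is submultiplicative.\<close>
    have f1: "f \<in> growth_class (\<lambda>_. 1)"
      using nonlinear_part_in_growth_class[OF f, of \<omega> "\<lambda>_. 1"] has_power_series_at_growth[OF G]
      by (simp add: F)
    obtain b where "\<And>k. k \<ge> 1 \<Longrightarrow> 1 \<le> exp (b * real k) * N k"
      using weight_seq_exponential_lower_bound[OF assms(5)] by blast
    then have "\<forall>\<^sub>F k in sequentially. 1 \<le> exp (b * real k) * N k"
      by (intro eventually_sequentiallyI[of 1])
    then have "h \<in> growth_class N"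
      unfolding h
      by (intro linearization_in_growth_class_Limsup[OF nonres f _ _ f1 N(1) p _ limsup]) simp_all
    with V show "h \<in> growth_class N \<inter> V_space 1" by blast
  next
    assume *: "F \<in> growth_class M \<inter> V_space 0 \<and> (\<forall>\<^sub>F k in sequentially. M k \<le> N k) \<and>
      (\<exists>p. index_seq p \<and>
        Limsup at_infinite_degree
          (\<lambda>\<alpha> :: nat ^ 'n. ereal (2 * (\<Sum>m=0..kappa p \<alpha>. Bruno_term \<omega> p m)
            - 1 / real \<bar>\<alpha>\<bar>\<^sub>m * ln (N \<bar>\<alpha>\<bar>\<^sub>m / M \<bar>\<alpha>\<bar>\<^sub>m))) < \<infinity>)"
    then obtain p where FM: "F \<in> growth_class M" and p: "index_seq p"
      and limsup: "Limsup at_infinite_degree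
          (\<lambda>\<alpha> :: nat ^ 'n. ereal (2 * (\<Sum>m=0..kappa p \<alpha>. Bruno_term \<omega> p m)
            - 1 / real \<bar>\<alpha>\<bar>\<^sub>m * ln (N \<bar>\<alpha>\<bar>\<^sub>m / M \<bar>\<alpha>\<bar>\<^sub>m))) < \<infinity>"
      by blast
    have ev: "\<forall>\<^sub>F k in sequentially. M k \<le> exp (0 * real k) * N k"
      using * by simp
    have "h \<in> growth_class N"
      unfolding h by (rule linearization_in_growth_class_Limsup[OF nonres f M fM[OF FM] N(1) p ev limsup])
    with V show "h \<in> growth_class N \<inter> V_space 1" by blast
  qed
qed

end
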